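(* Let $(s_{1,1},\ldots,s_{1,m})=\mathcal{N}(\sigma_1,\ldots,\sigma_m)$ be a Nikishin system, ${\bf n}\in\mathbb{Z}_+^m$ with $n_1\ge\cdots\ge n_m$, $\ell\in\{1,\ldots,m\}$, and ${\bf n}^\ell={\bf n}+{\bf e}_\ell$ with ${\bf e}_\ell$ the $\ell$-th canonical vector. For ${\bf p}\in\{{\bf n},{\bf n}^\ell\}$ let $Q_{\bf p}$ be a type II Hermite–Padé polynomial of $(\widehat{s}_{1,1},\ldots,\widehat{s}_{1,m})$ for ${\bf p}$, with real coefficients, and define $\Psi_{{\bf p},0}=Q_{\bf p}$, $\Psi_{{\bf p},k}(z)=\int\frac{\Psi_{{\bf p},k-1}(x)}{z-x}d\sigma_k(x)$, $k=1,\ldots,m$. Then for each $k=0,\ldots,m-1$, $\Psi_{{\bf n}^\ell,k}$ has at most $n_{k+1}+\cdots+n_m+1$ zeros in $\mathbb{C}\setminus\Delta_k$ (with $\Delta_0=\emptyset$) and at least $n_{k+1}+\cdots+n_m$ sign changes in $\Delta_{k+1}$; therefore all its zeros in $\mathbb{C}\setminus\Delta_k$ are real and simple. The zeros of $\Psi_{{\bf n},k}$ and $\Psi_{{\bf n}^\ell,k}$ in $\mathbb{C}\setminus\Delta_k$ interlace.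
   Context: For a bounded interval $\Delta\subset\mathbb{R}$, $\mathcal{M}(\Delta)$ is the class of finite Borel measures of constant sign whose compact support consists of infinitely many points, is contained in $\mathbb{R}$, and has $\Delta$ as the smallest interval containing it. The Cauchy transform of a measure $s$ is $\widehat{s}(z)=\int\frac{ds(x)}{z-x}$. Nikishin system: let $\Delta_1,\ldots,\Delta_m$ be bounded real intervals with $\Delta_j\cap\Delta_{j+1}=\emptyset$ ($j=1,\ldots,m-1$), and $\sigma_j\in\mathcal{M}(\Delta_j)$ with $\mathrm{Co}(\operatorname{supp}\sigma_j)=\Delta_j$. For $1\le j\le k\le m$, $s_{j,j}=\sigma_j$ and $ds_{j,k}(x)=\widehat{s}_{j+1,k}(x)\,d\sigma_j(x)$ for $j<k$; $\mathcal{N}(\sigma_1,\ldots,\sigma_m)=(s_{1,1},\ldots,s_{1,m})$. Type II Hermite–Padé polynomial for ${\bf p}\in\mathbb{Z}_+^m$, $|{\bf p}|=p_1+\cdots+p_m$: a polynomial $Q_{\bf p}\not\equiv0$ with $\deg Q_{\bf p}\le|{\bf p}|$ such that for some polynomials $P_{{\bf p},j}$, $Q_{\bf p}(z)\widehat{s}_{1,j}(z)-P_{{\bf p},j}(z)=\mathcal{O}(1/z^{p_j+1})$ as $z\to\infty$, $j=1,\ldots,m$. *)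

theory Defs
  imports "HOL-Complex_Analysis.Complex_Analysis" "HOL-Library.Landau_Symbols"
begin

definition msupp :: "real measure \<Rightarrow> real set" where
  "msupp M = {x. \<forall>e>0. emeasure M (ball x e) > 0}"

text \<open>The class M(Delta): the (nonnegative part of a constant-sign) finite Borel
  measure with compact, infinite support whose convex hull (smallest interval
  containing it) is Delta.\<close>
definition in_class_M :: "real measure \<Rightarrow> real set \<Rightarrow> bool" where
  "in_class_M M D \<longleftrightarrow> sets M = sets borel \<and> finite_measure M \<and>
     compact (msupp M) \<and> infinite (msupp M) \<and> convex hull (msupp M) = D"

text \<open>Cauchy transforms of the Nikishin measures.  The signed measure sigma_j is
  eps j * sig j with eps j in {-1,1}.  nik_aux sig eps d j is the Cauchy transform
  of s_{j,j+d}.\<close>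
primrec nik_aux :: "(nat \<Rightarrow> real measure) \<Rightarrow> (nat \<Rightarrow> real) \<Rightarrow> nat \<Rightarrow> nat \<Rightarrow> complex \<Rightarrow> complex" where
  "nik_aux sig eps 0 j z =
     complex_of_real (eps j) * (\<integral>x. 1 / (z - complex_of_real x) \<partial>sig j)"
| "nik_aux sig eps (Suc d) j z =
     complex_of_real (eps j) *
       (\<integral>x. nik_aux sig eps d (Suc j) (complex_of_real x) / (z - complex_of_real x) \<partial>sig j)"

definition nik_cauchy :: "(nat \<Rightarrow> real measure) \<Rightarrow> (nat \<Rightarrow> real) \<Rightarrow> nat \<Rightarrow> nat \<Rightarrow> complex \<Rightarrow> complex" where
  "nik_cauchy sig eps j k = nik_aux sig eps (k - j) j"

definition typeII_HP :: "(nat \<Rightarrow> real measure) \<Rightarrow> (nat \<Rightarrow> real) \<Rightarrow> nat \<Rightarrow> (nat \<Rightarrow> nat) \<Rightarrow> real poly \<Rightarrow> bool" where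
  "typeII_HP sig eps m p Q \<longleftrightarrow> Q \<noteq> 0 \<and> degree Q \<le> (\<Sum>j=1..m. p j) \<and>
     (\<forall>j\<in>{1..m}. \<exists>P :: complex poly.
        (\<lambda>z. poly (map_poly complex_of_real Q) z * nik_cauchy sig eps 1 j z - poly P z)
          \<in> O[at_infinity](\<lambda>z. 1 / z ^ (p j + 1)))"

primrec Psi :: "(nat \<Rightarrow> real measure) \<Rightarrow> (nat \<Rightarrow> real) \<Rightarrow> real poly \<Rightarrow> nat \<Rightarrow> complex \<Rightarrow> complex" where
  "Psi sig eps Q 0 z = poly (map_poly complex_of_real Q) z"
| "Psi sig eps Q (Suc k) z =
     complex_of_real (eps (Suc k)) *
       (\<integral>x. Psi sig eps Q k (complex_of_real x) / (z - complex_of_real x) \<partial>sig (Suc k))"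

definition sign_changes_ge :: "(real \<Rightarrow> real) \<Rightarrow> real set \<Rightarrow> nat \<Rightarrow> bool" where
  "sign_changes_ge f S N \<longleftrightarrow> (\<exists>xs :: nat \<Rightarrow> real. (\<forall>i\<le>N. xs i \<in> S) \<and>
     (\<forall>i<N. xs i < xs (Suc i) \<and> f (xs i) * f (xs (Suc i)) < 0))"

definition separates :: "complex set \<Rightarrow> complex set \<Rightarrow> bool" where
  "separates A B \<longleftrightarrow> (\<forall>a\<in>A. \<forall>b\<in>A. Re a < Re b \<and> (\<forall>c\<in>A. \<not> (Re a < Re c \<and> Re c < Re b))
      \<longrightarrow> (\<exists>c\<in>B. Re a < Re c \<and> Re c < Re b))"

definition interlace :: "complex set \<Rightarrow> complex set \<Rightarrow> bool" where
  "interlace A B \<longleftrightarrow> A \<subseteq> \<real> \<and> B \<subseteq> \<real> \<and> A \<inter> B = {} \<and> separates A B \<and> separates B A"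

end

theory Submission
  imports Defs "HOL-Computational_Algebra.Fundamental_Theorem_Algebra"
begin

text \<open>Fubini turns the Hermite--Pade conditions into \<open>\<integral> \<Psi>\<^bsub>k-1\<^esub>(x) x\<^sup>i d\<sigma>\<^sub>k(x) = 0\<close> for
  \<open>i < p\<^sub>k\<close>; this needs only \<open>p\<^sub>j \<le> p\<^sub>i + 1\<close> for \<open>i < j\<close>, which holds for \<open>n\<close> and for \<open>n\<^sup>l\<close>. If a real
  polynomial \<open>w\<close> without zeros on \<open>\<Delta>\<^sub>k\<close> divides \<open>\<Psi>\<^sub>k\<close> off \<open>\<Delta>\<^sub>k\<close>, then \<open>\<Psi>\<^bsub>k-1\<^esub> / w\<close> is orthogonal to
  all polynomials of degree less than \<open>p\<^sub>k + deg w\<close>, so \<open>\<Psi>\<^bsub>k-1\<^esub>\<close> has \<open>p\<^sub>k + deg w\<close> sign changes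
  on \<open>\<Delta>\<^sub>k\<close>. Iterating down to \<open>\<Psi>\<^sub>0 = Q\<close> bounds \<open>deg w\<close> by \<open>deg Q - p\<^sub>1 - \<dots> - p\<^sub>k\<close>; iterating from
  \<open>\<Psi>\<^sub>m\<close> gives \<open>p\<^bsub>k+1\<^esub> + \<dots> + p\<^sub>m\<close> sign changes of \<open>\<Psi>\<^sub>k\<close>. The two counts coincide for \<open>Q\<^sub>n\<close> and
  for \<open>Q\<close> with index \<open>n\<^sup>l\<close>, so all zeros of \<open>\<Psi>\<^sub>k\<close> lie in \<open>\<Delta>\<^bsub>k+1\<^esub>\<close>. They differ by at most one for a
  real linear combination of the two, so such a combination has only simple real zeros off
  \<open>\<Delta>\<^sub>k\<close>. Hence the Wronskian of the two functions has no real zero off \<open>\<Delta>\<^sub>k\<close>, and Rolle's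
  theorem for their quotient gives the interlacing.\<close>

section \<open>Sign changes and division by zeros\<close>

lemma sign_changes_ge_mono:
  assumes "sign_changes_ge f S N" "M \<le> N" "S \<subseteq> T"
  shows "sign_changes_ge f T M"
proof -
  obtain xs where xs': "(\<forall>i\<le>N. xs i \<in> S) \<and> (\<forall>i<N. xs i < xs (Suc i) \<and> f (xs i) * f (xs (Suc i)) < 0)"
    using assms(1) unfolding sign_changes_ge_def by (elim exE)
  then have xs: "\<And>i. i \<le> N \<Longrightarrow> xs i \<in> S"
    "\<And>i. i < N \<Longrightarrow> xs i < xs (Suc i) \<and> f (xs i) * f (xs (Suc i)) < 0"
    by auto
  with assms(2,3) show ?thesis
    unfolding sign_changes_ge_def by (intro exI[of _ xs]) (auto dest: order_trans)
qed

lemma sign_changes_ge_snoc: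
  assumes xs: "\<And>i. i \<le> N \<Longrightarrow> xs i \<in> S"
      "\<And>i. i < N \<Longrightarrow> xs i < xs (Suc i) \<and> f (xs i) * f (xs (Suc i)) < 0"
    and b: "b \<in> S" "xs N < b" "f (xs N) * f b < 0"
  shows "sign_changes_ge f S (Suc N)"
  unfolding sign_changes_ge_def
proof (intro exI[of _ "xs(Suc N := b)"] conjI allI impI)
  fix i assume "i \<le> Suc N"
  then show "(xs(Suc N := b)) i \<in> S" using xs(1)[of i] b(1) by auto
next
  fix i assume "i < Suc N"
  then consider "i < N" | "i = N" by linarith
  then show "(xs(Suc N := b)) i < (xs(Suc N := b)) (Suc i)"
    using xs(2)[of i] b by cases auto
next
  fix i assume "i < Suc N"
  then consider "i < N" | "i = N" by linarith
  then show "f ((xs(Suc N := b)) i) * f ((xs(Suc N := b)) (Suc i)) < 0"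
    using xs(2)[of i] b by cases auto
qed

text \<open>The conjunct fixing the sign of \<open>q\<close> to the right of \<open>S\<close> is what makes the
  induction go through: the part of \<open>S\<close> that can be reached with \<open>N\<close> sign changes carries a
  constant sign and is split off at its infimum.\<close>

lemma sign_matching_poly_aux:
  fixes h :: "real \<Rightarrow> real"
  assumes "\<not> sign_changes_ge h S (Suc N)"
  shows "\<exists>q \<delta>. q \<noteq> 0 \<and> degree q \<le> N \<and> (\<forall>b. (\<forall>x\<in>S. x \<le> b) \<longrightarrow> (\<forall>x>b. poly q x > 0)) \<and>
           (\<delta> = 1 \<or> \<delta> = -1) \<and> (\<forall>x\<in>S. 0 \<le> \<delta> * (h x * poly q x))"
  using assms
proof (induction N arbitrary: S)
  case 0
  have *: "h a * h b \<ge> 0" if "a \<in> S" "b \<in> S" "a < b" for a b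
  proof (rule ccontr)
    assume "\<not> h a * h b \<ge> 0"
    then have "sign_changes_ge h S (Suc 0)"
      using that by (intro sign_changes_ge_snoc[of 0 "\<lambda>_. a"]) auto
    with 0 show False by blast
  qed
  have "(\<forall>x\<in>S. 0 \<le> h x) \<or> (\<forall>x\<in>S. h x \<le> 0)"
  proof (rule ccontr)
    assume "\<not> ?thesis"
    then obtain a b where ab: "a \<in> S" "b \<in> S" "h a < 0" "0 < h b" by force
    then have "h a * h b < 0" "h b * h a < 0" by (auto simp: mult_neg_pos mult_pos_neg)
    then show False using *[of a b] *[of b a] ab by (cases a b rule: linorder_cases) auto
  qed
  then show ?case
  proof (elim disjE)
    assume "\<forall>x\<in>S. 0 \<le> h x"
    then show ?thesis by (intro exI[of _ 1] exI[of _ 1]) simp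
  next
    assume "\<forall>x\<in>S. h x \<le> 0"
    then show ?thesis by (intro exI[of _ 1] exI[of _ "-1"]) simp
  qed
next
  case (Suc N)
  define A where "A = {x\<in>S. sign_changes_ge h (S \<inter> {..x}) (Suc N)}"
  define L where "L = S - A"
  have LA: "x < a" if "x \<in> L" "a \<in> A" for x a
  proof (rule ccontr)
    assume "\<not> x < a"
    then have "S \<inter> {..a} \<subseteq> S \<inter> {..x}" by auto
    moreover have "sign_changes_ge h (S \<inter> {..a}) (Suc N)" using that unfolding A_def by blast
    ultimately have "sign_changes_ge h (S \<inter> {..x}) (Suc N)" using sign_changes_ge_mono by blast
    with that show False unfolding A_def L_def by blast
  qed
  have "\<not> sign_changes_ge h L (Suc N)"
  proof
    assume "sign_changes_ge h L (Suc N)"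
    then obtain xs where xs': "(\<forall>i\<le>Suc N. xs i \<in> L) \<and> (\<forall>i<Suc N. xs i < xs (Suc i) \<and> h (xs i) * h (xs (Suc i)) < 0)"
      unfolding sign_changes_ge_def by (elim exE)
    then have xs: "\<And>i. i \<le> Suc N \<Longrightarrow> xs i \<in> L"
      "\<And>i. i < Suc N \<Longrightarrow> xs i < xs (Suc i) \<and> h (xs i) * h (xs (Suc i)) < 0"
      by auto
    have "xs i \<le> xs (Suc N)" if "i \<le> Suc N" for i
      using that
    proof (induction rule: inc_induct)
      case (step j)
      then show ?case using xs(2)[of j] by linarith
    qed simp
    then have "sign_changes_ge h (S \<inter> {..xs (Suc N)}) (Suc N)"
      using xs unfolding sign_changes_ge_def L_def by (intro exI[of _ xs]) auto
    then have "xs (Suc N) \<in> A" using xs(1)[of "Suc N"] unfolding A_def L_def by auto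
    then show False using xs(1)[of "Suc N"] unfolding L_def by auto
  qed
  from Suc.IH[OF this] obtain q \<delta> where q': "q \<noteq> 0 \<and> degree q \<le> N \<and>
      (\<forall>b. (\<forall>x\<in>L. x \<le> b) \<longrightarrow> (\<forall>x>b. poly q x > 0)) \<and>
      (\<delta> = 1 \<or> \<delta> = -1) \<and> (\<forall>x\<in>L. 0 \<le> \<delta> * (h x * poly q x))"
    by (elim exE)
  then have q: "q \<noteq> 0" "degree q \<le> N" "\<delta> = 1 \<or> \<delta> = -1"
      "\<And>x. x \<in> L \<Longrightarrow> 0 \<le> \<delta> * (h x * poly q x)"
    by simp_all
  have q5: "poly q x > 0" if "\<forall>y\<in>L. y \<le> b" "b < x" for b x
    using q' that by blast
  \<comment> \<open>A chain witnessing \<open>b \<in> A\<close> ends at some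
    \<open>s \<le> b\<close> with \<open>h s \<noteq> 0\<close>. If \<open>h b\<close> and
    \<open>h b'\<close> had opposite signs, one of them would be opposite to \<open>h s\<close> and
    prolong the chain to \<open>Suc (Suc N)\<close> sign changes.\<close>
  have Asame: False if "b \<in> A" "b' \<in> A" "b < b'" "h b * h b' < 0" for b b'
  proof -
    have scb: "sign_changes_ge h (S \<inter> {..b}) (Suc N)" using \<open>b \<in> A\<close> unfolding A_def by blast
    obtain xs where xs': "(\<forall>i\<le>Suc N. xs i \<in> S \<inter> {..b}) \<and> (\<forall>i<Suc N. xs i < xs (Suc i) \<and> h (xs i) * h (xs (Suc i)) < 0)"
      using scb unfolding sign_changes_ge_def by (elim exE)
    then have xs: "\<And>i. i \<le> Suc N \<Longrightarrow> xs i \<in> S \<inter> {..b}"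
      "\<And>i. i < Suc N \<Longrightarrow> xs i < xs (Suc i) \<and> h (xs i) * h (xs (Suc i)) < 0"
      by auto
    define s where "s = xs (Suc N)"
    have s: "s \<in> S" "s \<le> b" "h s \<noteq> 0" using xs(1)[of "Suc N"] xs(2)[of N] unfolding s_def by auto
    have bS: "b \<in> S" "b' \<in> S" using that unfolding A_def by auto
    have xsS: "\<And>i. i \<le> Suc N \<Longrightarrow> xs i \<in> S" using xs by auto
    show False
    proof (cases "h s * h b < 0")
      case True
      then have "s \<noteq> b" by (auto simp: not_sum_power2_lt_zero mult_less_0_iff)
      then have "sign_changes_ge h S (Suc (Suc N))"
        using True s bS xs(2) xsS unfolding s_def by (intro sign_changes_ge_snoc[of _ xs]) auto
      then show False using Suc.prems by blast
    next
      case False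
      then have "h s * h b' < 0" using s(3) that(4) by (auto simp: mult_less_0_iff)
      then have "sign_changes_ge h S (Suc (Suc N))"
        using s bS xs(2) xsS that(3) unfolding s_def by (intro sign_changes_ge_snoc[of _ xs]) auto
      then show False using Suc.prems by blast
    qed
  qed
  have sgnA: "(\<forall>x\<in>A. 0 \<le> h x) \<or> (\<forall>x\<in>A. h x \<le> 0)"
  proof (rule ccontr)
    assume "\<not> ?thesis"
    then obtain a b where ab: "a \<in> A" "b \<in> A" "h a < 0" "0 < h b" by force
    then have "h a * h b < 0" "h b * h a < 0" by (auto simp: mult_neg_pos mult_pos_neg)
    then show False using Asame[of a b] Asame[of b a] ab by (cases a b rule: linorder_cases) auto
  qed
  consider "A = {}" | "L = {}" | "A \<noteq> {}" "L \<noteq> {}" by blast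
  then show ?case
  proof cases
    case 1
    then have "S = L" unfolding L_def by auto
    then show ?thesis using q' by (intro exI[of _ q] exI[of _ \<delta>]) (simp add: le_SucI)
  next
    case 2
    then have "A = S" unfolding L_def A_def by auto
    with sgnA consider "\<forall>x\<in>S. 0 \<le> h x" | "\<forall>x\<in>S. h x \<le> 0" by blast
    then show ?thesis
    proof cases
      case 1
      then show ?thesis by (intro exI[of _ 1] exI[of _ 1]) simp
    next
      case 2
      then show ?thesis by (intro exI[of _ 1] exI[of _ "-1"]) simp
    qed
  next
    case 3
    \<comment> \<open>\<open>L\<close> lies to the left of \<open>c\<close> and \<open>A\<close> to
      its right. The point \<open>c\<close> itself may belong to either, which is why the sign of
      \<open>q\<close> at \<open>c\<close> is obtained by a limit from the right.\<close>
    define c where "c = Inf A"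
    have Lc: "x \<le> c" if "x \<in> L" for x
      unfolding c_def using 3 LA[OF that] by (intro cInf_greatest) (auto intro: less_imp_le)
    have cA: "c \<le> a" if "a \<in> A" for a
    proof -
      obtain x where "x \<in> L" using 3 by blast
      then have "bdd_below A" by (intro bdd_belowI[of _ x]) (use LA in force)
      then show ?thesis unfolding c_def using that by (rule cInf_lower[rotated])
    qed
    have qpos: "poly q x > 0" if "x > c" for x using q5[of c x] Lc that by simp
    have qc: "poly q c \<ge> 0"
    proof (rule tendsto_lowerbound)
      show "(poly q \<longlongrightarrow> poly q c) (at_right c)"
        by (intro tendsto_intros tendsto_ident_at)
      show "\<forall>\<^sub>F x in at_right c. 0 \<le> poly q x"
        using qpos by (auto simp: eventually_at_filter intro!: always_eventually less_imp_le)
    qed simp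
    have qge: "poly q x \<ge> 0" if "x \<ge> c" for x
      using that qpos[of x] qc by (cases "x = c") auto
    have Scases: "x \<in> L \<or> x \<in> A" if "x \<in> S" for x using that unfolding L_def by auto
    have bc: "c \<le> b" if "\<And>x. x \<in> S \<Longrightarrow> x \<le> b" for b
    proof -
      obtain a where "a \<in> A" using 3 by blast
      then show ?thesis using cA[of a] that[of a] unfolding A_def by auto
    qed
    show ?thesis
    proof (cases "\<forall>x\<in>A. 0 \<le> \<delta> * h x")
      case True
      show ?thesis
      proof (intro exI[of _ q] exI[of _ \<delta>] conjI ballI allI impI)
        fix b x assume "\<forall>x\<in>S. x \<le> b" "b < x"
        then show "0 < poly q x" using bc[of b] qpos[of x] by auto
      next
        fix x assume "x \<in> S"
        then consider "x \<in> L" | "x \<in> A" using Scases by blast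
        then show "0 \<le> \<delta> * (h x * poly q x)"
        proof cases
          case 2
          then have "0 \<le> (\<delta> * h x) * poly q x"
            using True qge[of x] cA[of x] by - (rule mult_nonneg_nonneg, auto)
          then show ?thesis by (simp add: mult.assoc)
        qed (use q in auto)
      qed (use q in auto)
    next
      case False
      then have neg: "\<forall>x\<in>A. \<delta> * h x \<le> 0" using sgnA q(3) by auto
      \<comment> \<open>The new factor is nonpositive on \<open>L\<close> and nonnegative on
        \<open>A\<close>, so together with the negated \<open>\<delta>\<close> it repairs the
        mismatch. It is positive right of \<open>c\<close>, so the sign condition to the right of
        \<open>S\<close> survives.\<close>
      define q' where "q' = q * [:-c, 1:]"
      have q': "poly q' x = poly q x * (x - c)" for x unfolding q'_def by (simp add: algebra_simps)
      show ?thesis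
      proof (intro exI[of _ q'] exI[of _ "-\<delta>"] conjI ballI allI impI)
        show "q' \<noteq> 0" using q(1) unfolding q'_def by (simp only: mult_eq_0_iff) simp
        show "degree q' \<le> Suc N" using q(1,2) unfolding q'_def by (subst degree_mult_eq) simp_all
        show "- \<delta> = 1 \<or> - \<delta> = - 1" using q(3) by auto
      next
        fix b x assume "\<forall>x\<in>S. x \<le> b" "b < x"
        then show "0 < poly q' x" using bc[of b] qpos[of x] by (auto simp: q')
      next
        fix x assume "x \<in> S"
        then consider "x \<in> L" | "x \<in> A" using Scases by blast
        then show "0 \<le> - \<delta> * (h x * poly q' x)"
        proof cases
          case 1
          then have "0 \<le> (\<delta> * (h x * poly q x)) * (c - x)"
            using q(4)[of x] Lc[of x] by - (rule mult_nonneg_nonneg, auto)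
          then show ?thesis by (simp add: q' algebra_simps)
        next
          case 2
          then have "0 \<le> (- (\<delta> * h x)) * (poly q x * (x - c))"
            using neg qge[of x] cA[of x] by - (rule mult_nonneg_nonneg, auto)
          then show ?thesis by (simp add: q' algebra_simps)
        qed
      qed
    qed
  qed
qed

text \<open>The strict degree bound is what later allows \<open>q\<close> to be tested against
  \<open>N\<close> vanishing moments. For \<open>N = 0\<close> a single point of \<open>S\<close> is
  already a chain, so the first assumption is contradictory.\<close>

lemma sign_matching_poly:
  fixes h :: "real \<Rightarrow> real"
  assumes "\<not> sign_changes_ge h S N" "S \<noteq> {}"
  obtains q where "q \<noteq> 0" "degree q < N" "\<And>x. x \<in> S \<Longrightarrow> 0 \<le> h x * poly q x"
proof (cases N)
  case 0
  obtain x where "x \<in> S" using assms(2) by blast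
  then have "sign_changes_ge h S N" unfolding 0 sign_changes_ge_def by (intro exI[of _ "\<lambda>_. x"]) auto
  with assms show ?thesis by blast
next
  case (Suc M)
  from assms(1) have "\<not> sign_changes_ge h S (Suc M)" unfolding Suc .
  from sign_matching_poly_aux[OF this] obtain q \<delta> where q': "q \<noteq> 0 \<and> degree q \<le> M \<and>
      (\<forall>b. (\<forall>x\<in>S. x \<le> b) \<longrightarrow> (\<forall>x>b. poly q x > 0)) \<and>
      (\<delta> = 1 \<or> \<delta> = -1) \<and> (\<forall>x\<in>S. 0 \<le> \<delta> * (h x * poly q x))"
    by (elim exE)
  then have q: "q \<noteq> 0" "degree q \<le> M" "\<delta> = 1 \<or> \<delta> = -1"
      "\<And>x. x \<in> S \<Longrightarrow> 0 \<le> \<delta> * (h x * poly q x)"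
    by simp_all
  show ?thesis
  proof (rule that[of "smult \<delta> q"])
    show "0 \<le> h x * poly (smult \<delta> q) x" if "x \<in> S" for x
      using q(4)[OF that] by (simp only: poly_smult mult.left_commute)
  qed (use q(1-3) Suc in auto)
qed

text \<open>The intermediate value theorem gives a zero strictly inside each gap of the chain, and
  zeros from different gaps are distinct.\<close>

lemma sign_changes_ge_zeros:
  assumes "sign_changes_ge f I N" "is_interval I" "continuous_on I f"
  obtains X where "X \<subseteq> I" "finite X" "card X = N" "\<And>x. x \<in> X \<Longrightarrow> f x = 0"
proof -
  obtain xs where xs': "(\<forall>i\<le>N. xs i \<in> I) \<and> (\<forall>i<N. xs i < xs (Suc i) \<and> f (xs i) * f (xs (Suc i)) < 0)"
    using assms(1) unfolding sign_changes_ge_def by (elim exE)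
  then have xs: "\<And>i. i \<le> N \<Longrightarrow> xs i \<in> I"
    "\<And>i. i < N \<Longrightarrow> xs i < xs (Suc i) \<and> f (xs i) * f (xs (Suc i)) < 0"
    by auto
  have "\<exists>z. xs i < z \<and> z < xs (Suc i) \<and> f z = 0" if "i < N" for i
  proof -
    have sub: "{xs i..xs (Suc i)} \<subseteq> I"
      using mem_is_interval_1_I[OF assms(2) xs(1)[of i] xs(1)[of "Suc i"]] that by auto
    have cont: "continuous_on {xs i..xs (Suc i)} f"
      using continuous_on_subset[OF assms(3) sub] .
    have "\<exists>z\<ge>xs i. z \<le> xs (Suc i) \<and> f z = 0"
    proof (cases "f (xs i) < 0")
      case True
      then have "f (xs (Suc i)) > 0" using xs(2)[OF that] by (auto simp: mult_less_0_iff)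
      then show ?thesis using True xs(2)[OF that] cont by (intro IVT') auto
    next
      case False
      then have "f (xs (Suc i)) < 0" "f (xs i) > 0" using xs(2)[OF that] by (auto simp: mult_less_0_iff)
      then show ?thesis using xs(2)[OF that] cont by (intro IVT2') auto
    qed
    then obtain z where z: "xs i \<le> z" "z \<le> xs (Suc i)" "f z = 0" by blast
    moreover have "z \<noteq> xs i" "z \<noteq> xs (Suc i)" using xs(2)[OF that] z by auto
    ultimately show ?thesis by (intro exI[of _ z]) auto
  qed
  then obtain z where z: "\<And>i. i < N \<Longrightarrow> xs i < z i \<and> z i < xs (Suc i) \<and> f (z i) = 0" by metis
  have mono: "xs i \<le> xs j" if "i \<le> j" "j \<le> N" for i j
    using that
  proof (induction rule: dec_induct)
    case (step k)
    then show ?case using xs(2)[of k] by linarith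
  qed simp
  have zlt: "z i < z j" if "i < j" "j < N" for i j
    using mono[of "Suc i" j] z[of i] z[of j] that by force
  have "inj_on z {..<N}"
    by (rule linorder_inj_onI) (use zlt in force)+
  then show ?thesis
  proof (intro that[of "z ` {..<N}"])
    show "z ` {..<N} \<subseteq> I"
    proof
      fix x assume "x \<in> z ` {..<N}"
      then obtain i where "i < N" "x = z i" by auto
      then show "x \<in> I" using mem_is_interval_1_I[OF assms(2) xs(1)[of i] xs(1)[of "Suc i"]] z[of i]
        by auto
    qed
  qed (use z in \<open>auto simp: card_image\<close>)
qed

section \<open>Cancelling zeros of holomorphic functions and polynomials\<close>

lemma continuous_on_eq_off_finite:
  fixes f g :: "complex \<Rightarrow> complex"
  assumes "open S" "continuous_on S f" "continuous_on S g" "finite X"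
    and eq: "\<And>z. z \<in> S \<Longrightarrow> z \<notin> X \<Longrightarrow> f z = g z" and a: "a \<in> S"
  shows "f a = g a"
proof -
  have "((\<lambda>z. f z - g z) \<longlongrightarrow> f a - g a) (at a)"
    using assms(1-3) a by (intro tendsto_diff) (auto simp: continuous_on_eq_continuous_at isCont_def)
  moreover have "\<forall>\<^sub>F z in at a. f z - g z = 0"
  proof -
    have "\<forall>\<^sub>F z in at a. z \<in> S - (X - {a})"
      using assms(1,4) a by (intro eventually_at_in_open') (auto intro!: finite_imp_closed)
    moreover have "\<forall>\<^sub>F z in at a. z \<noteq> a" by (simp add: eventually_at_filter)
    ultimately show ?thesis by eventually_elim (use eq in auto)
  qed
  then have "((\<lambda>z. f z - g z) \<longlongrightarrow> 0) (at a)"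
    by (rule tendsto_eventually)
  ultimately have "f a - g a = 0"
    by (rule tendsto_unique[OF trivial_limit_at])
  then show ?thesis by simp
qed

lemma holomorphic_divide_zero:
  assumes "F holomorphic_on S" "open S" "F a = 0"
  obtains K where "K holomorphic_on S" "\<And>z. z \<in> S \<Longrightarrow> F z = (z - a) * K z"
proof (rule that)
  show "(\<lambda>z. if z = a then deriv F a else (F z - F a) / (z - a)) holomorphic_on S"
    by (rule pole_lemma_open[OF assms(1,2)])
  show "F z = (z - a) * (if z = a then deriv F a else (F z - F a) / (z - a))" for z
    using assms(3) by simp
qed

lemma holomorphic_divide_zeros:
  assumes "finite X" "F holomorphic_on S" "open S" "X \<subseteq> S" "\<And>a. a \<in> X \<Longrightarrow> F a = 0"
  shows "\<exists>K. K holomorphic_on S \<and> (\<forall>z\<in>S. F z = poly (\<Prod>a\<in>X. [:-a, 1:]) z * K z)"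
  using assms
proof (induction X arbitrary: F rule: finite_induct)
  case empty
  then show ?case by (intro exI[of _ F]) auto
next
  case (insert a X)
  obtain G where G: "G holomorphic_on S" "\<And>z. z \<in> S \<Longrightarrow> F z = (z - a) * G z"
    using holomorphic_divide_zero[OF insert.prems(1,2)] insert.prems(4) by blast
  have "G b = 0" if "b \<in> X" for b
    using G(2)[of b] insert that by auto
  then obtain K where "K holomorphic_on S" "\<forall>z\<in>S. G z = poly (\<Prod>a\<in>X. [:-a, 1:]) z * K z"
    using insert.IH[OF G(1)] insert.prems by auto
  then show ?case using G(2) insert.hyps
    by (intro exI[of _ K]) (auto simp: algebra_simps)
qed

lemma complex_poly_split:
  fixes W :: "complex poly"
  assumes "degree W = Suc n"
  obtains a V where "W = [:-a, 1:] * V" "degree V = n"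
proof -
  obtain a where "poly W a = 0" using alg_closed_imp_poly_has_root[of W] assms by auto
  then obtain V where V: "W = [:-a, 1:] * V" by (auto simp: poly_eq_0_iff_dvd elim: dvdE)
  then have "V \<noteq> 0" using assms by auto
  then have "degree W = 1 + degree V" unfolding V by (subst degree_mult_eq) auto
  then show ?thesis using that V assms by simp
qed

text \<open>Every root of \<open>W\<close> is a root of \<open>Q\<close>, because \<open>K\<close>
  is finite there. Cancelling the common linear factor leaves the same identity off the root, and
  continuity of \<open>K\<close> restores it at the root, so the roots of \<open>W\<close> can be
  removed one at a time.\<close>

lemma degree_le_of_continuous_quotient:
  fixes Q W :: "complex poly"
  assumes "Q \<noteq> 0" "continuous_on UNIV K" "\<And>z. poly Q z = poly W z * K z"
  shows "degree W \<le> degree Q"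
  using assms
proof (induction "degree W" arbitrary: W Q)
  case (Suc n)
  obtain a V where V: "W = [:-a, 1:] * V" "degree V = n"
    using complex_poly_split[of W n] Suc.hyps by metis
  have "poly Q a = 0" using Suc.prems(3)[of a] V by simp
  then obtain R where R: "Q = [:-a, 1:] * R" by (auto simp: poly_eq_0_iff_dvd elim: dvdE)
  have "R \<noteq> 0" using R Suc.prems by auto
  have off: "poly R z = poly V z * K z" if "z \<noteq> a" for z
  proof -
    have "(z - a) * poly R z = (z - a) * (poly V z * K z)"
      using Suc.prems(3)[of z] by (simp add: V R algebra_simps)
    then show ?thesis using that by simp
  qed
  have "poly R z = poly V z * K z" for z
  proof (rule continuous_on_eq_off_finite[of UNIV "poly R" "\<lambda>z. poly V z * K z" "{a}"])
    show "continuous_on UNIV (\<lambda>z. poly V z * K z)"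
      by (intro continuous_intros Suc.prems(2))
  qed (use off in \<open>auto intro!: continuous_intros\<close>)
  from Suc.hyps(1)[OF V(2)[symmetric] \<open>R \<noteq> 0\<close> Suc.prems(2) this]
  have "degree V \<le> degree R" .
  moreover have "degree Q = Suc (degree R)" using \<open>R \<noteq> 0\<close> unfolding R by (subst degree_mult_eq) auto
  ultimately show ?case using V Suc.hyps by simp
qed simp

section \<open>Cauchy transforms of compactly supported measures\<close>

text \<open>The measure \<open>h dM\<close> is kept as a pair of a positive measure and a complex
  density. The signed measures of a Nikishin system are thus never formed as measures.\<close>

definition cauchy_transform :: "real measure \<Rightarrow> (real \<Rightarrow> complex) \<Rightarrow> complex \<Rightarrow> complex" where
  "cauchy_transform M h z = (\<integral>x. h x / (z - complex_of_real x) \<partial>M)"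

text \<open>Densities such as Cauchy transforms are controlled only away from another interval.
  Boundedness is therefore asked on the carrier \<open>D\<close> alone, measurability on the whole
  line.\<close>

definition weight :: "real set \<Rightarrow> (real \<Rightarrow> complex) \<Rightarrow> bool" where
  "weight D h \<longleftrightarrow> h \<in> borel_measurable borel \<and> bounded (h ` D)"

lemma weight_mult:
  assumes "weight D f" "weight D g"
  shows "weight D (\<lambda>x. f x * g x)"
proof -
  obtain B C where "\<And>x. x \<in> D \<Longrightarrow> norm (f x) \<le> B" "\<And>x. x \<in> D \<Longrightarrow> norm (g x) \<le> C"
    using assms unfolding weight_def bounded_iff by auto
  then have "norm (f x * g x) \<le> B * C" if "x \<in> D" for x
    unfolding norm_mult using that by (intro mult_mono) (auto intro: order_trans[OF norm_ge_zero])
  then have "bounded ((\<lambda>x. f x * g x) ` D)" unfolding bounded_iff by auto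
  then show ?thesis using assms unfolding weight_def by auto
qed

lemma weight_const: "weight D (\<lambda>x. c)"
  unfolding weight_def bounded_iff by auto

lemma weight_continuous:
  assumes "compact D" "h \<in> borel_measurable borel" "continuous_on D h"
  shows "weight D h"
  using assms unfolding weight_def by (auto intro: compact_imp_bounded compact_continuous_image)

lemma weight_poly:
  assumes "compact D"
  shows "weight D (\<lambda>x. poly P (complex_of_real x))"
  by (rule weight_continuous[OF assms])
     (intro borel_measurable_continuous_onI continuous_intros)+

lemma weight_inverse:
  assumes "compact D" "z \<notin> complex_of_real ` D"
  shows "weight D (\<lambda>x. 1 / (z - complex_of_real x))"
  using assms by (intro weight_continuous) (auto intro!: continuous_intros)

lemma weight_divide:
  assumes "compact D" "weight D h" "z \<notin> complex_of_real ` D"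
  shows "weight D (\<lambda>x. h x / (z - complex_of_real x))"
  using weight_mult[OF assms(2) weight_inverse[OF assms(1,3)]] by simp

lemma weight_of_real_mult:
  assumes "compact D" "weight D h"
  shows "weight D (\<lambda>x. h x * complex_of_real x ^ k)"
  using weight_mult[OF assms(2) weight_poly[OF assms(1), of "monom 1 k"]] by (simp add: poly_monom)

lemma poly_tendsto_0_at_infinity:
  fixes P :: "complex poly"
  assumes "(poly P \<longlongrightarrow> 0) at_infinity"
  shows "P = 0"
proof (cases "degree P > 0")
  case True
  from filterlim_poly_at_infinity[OF this] show ?thesis
    using not_tendsto_and_filterlim_at_infinity[OF _ assms] by (simp add: trivial_limit_at_infinity)
next
  case False
  then obtain c where P: "P = [:c:]" by (auto elim: degree_eq_zeroE)
  then have "poly P = (\<lambda>z. c)" by auto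
  with assms have "((\<lambda>z::complex. c) \<longlongrightarrow> 0) at_infinity" by simp
  then have "c = 0" by (rule tendsto_unique[OF trivial_limit_at_infinity tendsto_const])
  then show ?thesis using P by simp
qed

locale compact_measure = finite_measure M for M :: "real measure" +
  fixes D :: "real set"
  assumes sets_M [measurable_cong]: "sets M = sets borel"
    and compact_D: "compact D"
    and AE_D: "AE x in M. x \<in> D"
begin

lemma closed_CD: "closed (complex_of_real ` D)"
  by (intro compact_imp_closed compact_continuous_image compact_D continuous_intros)

lemma open_CD: "open (- complex_of_real ` D)"
  using closed_CD by (rule open_Compl)

lemma weight_measurable: "weight D h \<Longrightarrow> h \<in> borel_measurable M"
  unfolding weight_def using sets_M by (simp cong: measurable_cong_sets)

lemma weight_integrable:
  assumes "weight D h"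
  shows "integrable M h"
proof -
  obtain B where "\<And>x. x \<in> D \<Longrightarrow> norm (h x) \<le> B"
    using assms unfolding weight_def bounded_iff by auto
  then have "AE x in M. norm (h x) \<le> B" using AE_D by auto
  then show ?thesis using weight_measurable[OF assms] by (rule integrable_const_bound)
qed

lemma integral_cong_D:
  fixes f g :: "real \<Rightarrow> complex"
  assumes "f \<in> borel_measurable borel" "g \<in> borel_measurable borel" "\<And>x. x \<in> D \<Longrightarrow> f x = g x"
  shows "(\<integral>x. f x \<partial>M) = (\<integral>x. g x \<partial>M)"
  using AE_D assms sets_M by (intro integral_cong_AE) (auto cong: measurable_cong_sets)

lemma norm_integral_le:
  assumes "weight D h" "\<And>x. x \<in> D \<Longrightarrow> norm (h x) \<le> B"
  shows "norm (\<integral>x. h x \<partial>M) \<le> B * measure M (space M)"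
proof -
  have "norm (\<integral>x. h x \<partial>M) \<le> (\<integral>x. norm (h x) \<partial>M)" by (rule integral_norm_bound)
  also have "\<dots> \<le> (\<integral>x. B \<partial>M)"
    using AE_D assms(2) weight_integrable[OF assms(1)] by (intro integral_mono_AE) auto
  finally show ?thesis by (simp add: mult.commute)
qed

lemma norm_cauchy_transform_le:
  assumes "weight D h" "\<And>x. x \<in> D \<Longrightarrow> norm (h x) \<le> B" "0 < \<delta>" "0 \<le> B"
    and "\<And>x. x \<in> D \<Longrightarrow> \<delta> \<le> norm (z - complex_of_real x)"
  shows "norm (cauchy_transform M h z) \<le> B / \<delta> * measure M (space M)"
  unfolding cauchy_transform_def
proof (rule norm_integral_le)
  show "weight D (\<lambda>x. h x / (z - complex_of_real x))"
    using assms by (intro weight_divide compact_D) force+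
  show "norm (h x / (z - complex_of_real x)) \<le> B / \<delta>" if "x \<in> D" for x
    unfolding norm_divide using assms that by (intro frac_le) auto
qed

text \<open>The resolvent identity \<open>1/(z-x) - 1/(a-x) = (a-z)/((z-x)(a-x))\<close>,
  integrated. Continuity, differentiability and the division by a zero at \<open>a\<close> all come
  from it.\<close>

lemma cauchy_transform_diff:
  assumes "weight D h" "z \<notin> complex_of_real ` D" "a \<notin> complex_of_real ` D"
  shows "cauchy_transform M h z - cauchy_transform M h a
       = (a - z) * cauchy_transform M (\<lambda>x. h x / (a - complex_of_real x)) z"
proof -
  note w = weight_divide[OF compact_D]
  have "cauchy_transform M h z - cauchy_transform M h a
      = (\<integral>x. h x / (z - complex_of_real x) - h x / (a - complex_of_real x) \<partial>M)"
    unfolding cauchy_transform_def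
    using assms by (intro Bochner_Integration.integral_diff[symmetric] weight_integrable w)
  also have "\<dots> = (\<integral>x. (a - z) * (h x / (a - complex_of_real x) / (z - complex_of_real x)) \<partial>M)"
  proof (rule integral_cong_D)
    fix x assume "x \<in> D"
    then have "z - complex_of_real x \<noteq> 0" "a - complex_of_real x \<noteq> 0" using assms by auto
    then show "h x / (z - complex_of_real x) - h x / (a - complex_of_real x)
        = (a - z) * (h x / (a - complex_of_real x) / (z - complex_of_real x))"
      by (simp add: field_simps)
  qed (use assms(1) in \<open>auto simp: weight_def\<close>)
  finally show ?thesis unfolding cauchy_transform_def integral_mult_right_zero by simp
qed

lemma continuous_cauchy_transform:
  assumes h: "weight D h"
  shows "continuous_on (- complex_of_real ` D) (cauchy_transform M h)"
proof -
  have "isCont (cauchy_transform M h) a" if a: "a \<in> - complex_of_real ` D" for a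
  proof -
    obtain e where e: "e > 0" "ball a e \<subseteq> - complex_of_real ` D"
      using open_CD a unfolding open_contains_ball by blast
    define g where "g = (\<lambda>x. h x / (a - complex_of_real x))"
    have g: "weight D g" unfolding g_def using a by (intro weight_divide compact_D h) auto
    obtain B where B: "B > 0" "\<And>x. x \<in> D \<Longrightarrow> norm (g x) \<le> B"
      using g unfolding weight_def bounded_pos by auto
    \<comment> \<open>On the ball of half the radius every point keeps distance at least
      \<open>e/2\<close> from \<open>D\<close>, so \<open>C\<close> bounds the transform of
      \<open>g\<close> uniformly there.\<close>
    define C where "C = B / (e/2) * measure M (space M)"
    have bd: "norm (cauchy_transform M h z - cauchy_transform M h a) \<le> norm (a - z) * C"
      if "z \<in> ball a (e/2)" for z
    proof -
      have far: "e/2 \<le> norm (z - complex_of_real x)" if "x \<in> D" for x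
      proof -
        have "complex_of_real x \<notin> ball a e" using e(2) that by auto
        then have "e \<le> dist a (complex_of_real x)" by auto
        also have "\<dots> \<le> dist a z + dist z (complex_of_real x)" by (rule dist_triangle)
        finally show ?thesis using \<open>z \<in> ball a (e/2)\<close> by (auto simp: dist_norm)
      qed
      then have z: "z \<notin> complex_of_real ` D" using e(1) by force
      have "norm (cauchy_transform M g z) \<le> C"
        unfolding C_def using B e(1) far by (intro norm_cauchy_transform_le g) auto
      then show ?thesis
        using cauchy_transform_diff[OF h z, of a] a
        unfolding g_def by (auto simp: norm_mult intro!: mult_left_mono)
    qed
    have "((\<lambda>z. cauchy_transform M h z - cauchy_transform M h a) \<longlongrightarrow> 0) (at a)"
    proof (rule Lim_null_comparison)
      show "\<forall>\<^sub>F z in at a. norm (cauchy_transform M h z - cauchy_transform M h a) \<le> norm (a - z) * C"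
        using e(1) bd by (auto intro!: eventually_at_in_open'[THEN eventually_mono, of "ball a (e/2)"])
      have "((\<lambda>z. norm (a - z) * C) \<longlongrightarrow> norm (a - a) * C) (at a)"
        by (intro tendsto_intros)
      then show "((\<lambda>z. norm (a - z) * C) \<longlongrightarrow> 0) (at a)" by simp
    qed
    then show ?thesis unfolding isCont_def by (simp add: LIM_zero_iff)
  qed
  then show ?thesis by (intro continuous_at_imp_continuous_on) auto
qed

text \<open>By the resolvent identity the difference quotient at \<open>a\<close> is minus the
  transform of \<open>h(x)/(a-x)\<close>, which is already known to be continuous at
  \<open>a\<close>.\<close>

lemma holomorphic_cauchy_transform:
  assumes h: "weight D h"
  shows "cauchy_transform M h holomorphic_on - complex_of_real ` D"
  unfolding holomorphic_on_open[OF open_CD]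
proof (intro ballI)
  fix a assume a: "a \<in> - complex_of_real ` D"
  define g where "g = (\<lambda>x. h x / (a - complex_of_real x))"
  have g: "weight D g" unfolding g_def using a by (intro weight_divide compact_D h) auto
  have "((\<lambda>z. (cauchy_transform M h z - cauchy_transform M h a) / (z - a))
      \<longlongrightarrow> - cauchy_transform M g a) (at a)"
  proof (rule Lim_transform_eventually)
    have "isCont (cauchy_transform M g) a"
      using continuous_cauchy_transform[OF g] a open_CD by (simp add: continuous_on_eq_continuous_at)
    then show "((\<lambda>z. - cauchy_transform M g z) \<longlongrightarrow> - cauchy_transform M g a) (at a)"
      unfolding isCont_def by (intro tendsto_minus)
    have "\<forall>\<^sub>F z in at a. z \<in> - complex_of_real ` D"
      by (rule eventually_at_in_open'[OF open_CD a])
    moreover have "\<forall>\<^sub>F z in at a. z \<noteq> a" by (simp add: eventually_at_filter)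
    ultimately show "\<forall>\<^sub>F z in at a. - cauchy_transform M g z
        = (cauchy_transform M h z - cauchy_transform M h a) / (z - a)"
    proof eventually_elim
      case (elim z)
      have "cauchy_transform M h z - cauchy_transform M h a = - cauchy_transform M g z * (z - a)"
        using cauchy_transform_diff[OF h, of z a] a elim unfolding g_def by (simp add: algebra_simps)
      then show ?case using elim by (simp add: eq_divide_eq)
    qed
  qed
  then show "\<exists>f'. (cauchy_transform M h has_field_derivative f') (at a)"
    by (intro exI) (simp add: has_field_derivative_iff)
qed

text \<open>From \<open>z/(z-x) = x/(z-x) + 1\<close>: a factor \<open>z\<close> moves into the
  density as \<open>x\<close>, at the price of the zeroth moment.\<close>

lemma cauchy_transform_times:
  assumes h: "weight D h" and z: "z \<notin> complex_of_real ` D"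
  shows "z * cauchy_transform M h z
       = cauchy_transform M (\<lambda>x. h x * complex_of_real x) z + (\<integral>x. h x \<partial>M)"
proof -
  have hx: "weight D (\<lambda>x. h x * complex_of_real x)"
    using weight_of_real_mult[OF compact_D h, of 1] by simp
  have "(\<integral>x. h x * complex_of_real x / (z - complex_of_real x) \<partial>M) + (\<integral>x. h x \<partial>M)
      = (\<integral>x. h x * complex_of_real x / (z - complex_of_real x) + h x \<partial>M)"
    by (intro Bochner_Integration.integral_add[symmetric] weight_integrable weight_divide compact_D hx h z)
  also have "\<dots> = (\<integral>x. z * (h x / (z - complex_of_real x)) \<partial>M)"
  proof (rule integral_cong_D)
    fix x assume "x \<in> D"
    then have "z - complex_of_real x \<noteq> 0" using z by auto
    then show "h x * complex_of_real x / (z - complex_of_real x) + h x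
        = z * (h x / (z - complex_of_real x))"
      by (simp add: field_simps)
  qed (use h in \<open>auto simp: weight_def\<close>)
  finally show ?thesis unfolding cauchy_transform_def integral_mult_right_zero by simp
qed

lemma cauchy_transform_add:
  assumes "weight D f" "weight D g" "z \<notin> complex_of_real ` D"
  shows "cauchy_transform M (\<lambda>x. f x + g x) z = cauchy_transform M f z + cauchy_transform M g z"
  unfolding cauchy_transform_def add_divide_distrib
  using assms by (intro Bochner_Integration.integral_add weight_integrable weight_divide compact_D)

lemma cauchy_transform_cmult:
  "cauchy_transform M (\<lambda>x. c * f x) z = c * cauchy_transform M f z"
  unfolding cauchy_transform_def by (simp flip: times_divide_eq_right)

lemma power_times_cauchy_transform:
  assumes h: "weight D h"
  shows "\<exists>c. \<forall>z. z \<notin> complex_of_real ` D \<longrightarrow> z ^ k * cauchy_transform M h z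
      = cauchy_transform M (\<lambda>x. h x * complex_of_real x ^ k) z + (\<Sum>i<k. c i * z ^ i)"
proof (induction k)
  case (Suc k)
  then obtain c where c: "\<And>z. z \<notin> complex_of_real ` D \<Longrightarrow> z ^ k * cauchy_transform M h z
      = cauchy_transform M (\<lambda>x. h x * complex_of_real x ^ k) z + (\<Sum>i<k. c i * z ^ i)"
    by blast
  define I where "I = (\<integral>x. h x * complex_of_real x ^ k \<partial>M)"
  show ?case
  \<comment> \<open>Multiplication by \<open>z\<close> shifts the old coefficients up by one and the
    moment \<open>I\<close> enters as the constant term, so the correction keeps degree below the
    exponent.\<close>
  proof (intro exI[of _ "\<lambda>i. case i of 0 \<Rightarrow> I | Suc j \<Rightarrow> c j"] allI impI)
    fix z assume z: "z \<notin> complex_of_real ` D"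
    have "z ^ Suc k * cauchy_transform M h z = z * (z ^ k * cauchy_transform M h z)" by simp
    also have "\<dots> = z * cauchy_transform M (\<lambda>x. h x * complex_of_real x ^ k) z
        + (\<Sum>i<k. c i * z ^ Suc i)"
      unfolding c[OF z] by (simp add: algebra_simps sum_distrib_left)
    also have "z * cauchy_transform M (\<lambda>x. h x * complex_of_real x ^ k) z
        = cauchy_transform M (\<lambda>x. h x * complex_of_real x ^ Suc k) z + I"
      unfolding I_def cauchy_transform_times[OF weight_of_real_mult[OF compact_D h] z]
      by (simp add: mult_ac)
    finally show "z ^ Suc k * cauchy_transform M h z
        = cauchy_transform M (\<lambda>x. h x * complex_of_real x ^ Suc k) z
          + (\<Sum>i<Suc k. (case i of 0 \<Rightarrow> I | Suc j \<Rightarrow> c j) * z ^ i)"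
      by (simp add: sum.lessThan_Suc_shift del: sum.lessThan_Suc)
  qed
qed auto

text \<open>This turns the remainder of a Hermite--Pade condition into a single Cauchy transform, up
  to a polynomial whose shape is irrelevant.\<close>

lemma poly_times_cauchy_transform:
  assumes h: "weight D h"
  shows "\<exists>P. \<forall>z. z \<notin> complex_of_real ` D \<longrightarrow> poly Q z * cauchy_transform M h z
      = cauchy_transform M (\<lambda>x. poly Q (complex_of_real x) * h x) z + poly P z"
proof (induction Q)
  case 0
  show ?case by (intro exI[of _ 0]) (simp add: cauchy_transform_def)
next
  case (pCons a Q)
  then obtain P where P: "\<And>z. z \<notin> complex_of_real ` D \<Longrightarrow> poly Q z * cauchy_transform M h z
      = cauchy_transform M (\<lambda>x. poly Q (complex_of_real x) * h x) z + poly P z"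
    by blast
  have qh: "weight D (\<lambda>x. poly Q (complex_of_real x) * h x)"
    by (intro weight_mult weight_poly compact_D h)
  define I where "I = (\<integral>x. poly Q (complex_of_real x) * h x \<partial>M)"
  show ?case
  proof (intro exI[of _ "pCons I P"] allI impI)
    fix z assume z: "z \<notin> complex_of_real ` D"
    have "poly (pCons a Q) z * cauchy_transform M h z
        = a * cauchy_transform M h z + z * (poly Q z * cauchy_transform M h z)"
      by (simp add: algebra_simps)
    also have "\<dots> = cauchy_transform M (\<lambda>x. a * h x) z
        + cauchy_transform M (\<lambda>x. poly Q (complex_of_real x) * h x * complex_of_real x) z
        + I + z * poly P z"
      unfolding P[OF z] distrib_left cauchy_transform_times[OF qh z] I_def
      by (simp add: cauchy_transform_cmult algebra_simps)
    also have "cauchy_transform M (\<lambda>x. a * h x) z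
        + cauchy_transform M (\<lambda>x. poly Q (complex_of_real x) * h x * complex_of_real x) z
        = cauchy_transform M (\<lambda>x. poly (pCons a Q) (complex_of_real x) * h x) z"
      using weight_of_real_mult[OF compact_D qh, of 1] z
      by (subst cauchy_transform_add[symmetric])
         (auto intro: weight_mult weight_const h simp: algebra_simps)
    finally show "poly (pCons a Q) z * cauchy_transform M h z
        = cauchy_transform M (\<lambda>x. poly (pCons a Q) (complex_of_real x) * h x) z
          + poly (pCons I P) z" by simp
  qed
qed

lemma eventually_far: "\<forall>\<^sub>F z in at_infinity. \<forall>x\<in>D. norm z / 2 \<le> norm (z - complex_of_real x)"
proof -
  obtain R where R: "\<And>x. x \<in> D \<Longrightarrow> \<bar>x\<bar> \<le> R"
    using compact_imp_bounded[OF compact_D] unfolding bounded_iff by auto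
  show ?thesis
  proof (rule eventually_at_infinityI[of "2 * \<bar>R\<bar>"], intro ballI)
    fix z :: complex and x assume "2 * \<bar>R\<bar> \<le> norm z" "x \<in> D"
    then show "norm z / 2 \<le> norm (z - complex_of_real x)"
      using norm_triangle_ineq2[of z "complex_of_real x"] R[of x] by simp
  qed
qed

lemma eventually_off: "\<forall>\<^sub>F z in at_infinity. z \<notin> complex_of_real ` D"
proof -
  have "\<forall>\<^sub>F z :: complex in at_infinity. norm z \<ge> 1"
    by (rule eventually_at_infinityI[of 1]) auto
  with eventually_far show ?thesis by eventually_elim force
qed

lemma cauchy_transform_tendsto_0:
  assumes h: "weight D h"
  shows "(cauchy_transform M h \<longlongrightarrow> 0) at_infinity"
proof -
  obtain B where B: "B > 0" "\<And>x. x \<in> D \<Longrightarrow> norm (h x) \<le> B"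
    using h unfolding weight_def bounded_pos by auto
  define r where "r = 2 * B * measure M (space M)"
  have "r \<ge> 0" unfolding r_def using B(1) by simp
  have "\<forall>\<^sub>F z :: complex in at_infinity. norm z \<ge> 1"
    by (rule eventually_at_infinityI[of 1]) auto
  with eventually_far
  have "\<forall>\<^sub>F z::complex in at_infinity. norm (cauchy_transform M h z)
      \<le> norm (complex_of_real r * inverse z)"
  proof eventually_elim
    case (elim z)
    then have "norm (cauchy_transform M h z) \<le> B / (norm z / 2) * measure M (space M)"
      using B by (intro norm_cauchy_transform_le[OF h]) auto
    also have "B / (norm z / 2) * measure M (space M) = r / norm z"
      unfolding r_def by simp
    also have "\<dots> = norm (complex_of_real r * inverse z)"
      using \<open>r \<ge> 0\<close> unfolding norm_mult norm_inverse divide_inverse by simp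
    finally show ?case .
  qed
  moreover have "((\<lambda>z::complex. norm (complex_of_real r * inverse z)) \<longlongrightarrow> 0) at_infinity"
    by (intro tendsto_norm_zero tendsto_mult_right_zero tendsto_inverse_0)
  ultimately show ?thesis by (rule Lim_null_comparison)
qed

text \<open>Multiplying by \<open>z\<close> lowers the decay by one order and puts the zeroth moment
  into the constant coefficient of the polynomial part. As everything still tends to 0, that
  polynomial vanishes; the induction continues with the density \<open>x h(x)\<close>.\<close>

lemma moments_of_decay:
  assumes "weight D h"
    and "(\<lambda>z. cauchy_transform M h z + poly P z) \<in> O[at_infinity](\<lambda>z. 1 / z ^ (p + 1))"
    and "i < p"
  shows "(\<integral>x. h x * complex_of_real x ^ i \<partial>M) = 0"
  using assms
proof (induction p arbitrary: h P i)
  case (Suc p)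
  define h' where "h' = (\<lambda>x. h x * complex_of_real x)"
  have h': "weight D h'"
    unfolding h'_def using weight_of_real_mult[OF compact_D Suc.prems(1), of 1] by simp
  define P' where "P' = pCons (\<integral>x. h x \<partial>M) P"
  have "(\<lambda>z. z * (cauchy_transform M h z + poly P z)) \<in> O[at_infinity](\<lambda>z. z * (1 / z ^ (Suc p + 1)))"
    by (intro landau_o.big.mult_left Suc.prems)
  also have "(\<lambda>z. z * (cauchy_transform M h z + poly P z)) \<in> O[at_infinity](\<lambda>z. z * (1 / z ^ (Suc p + 1)))
      \<longleftrightarrow> (\<lambda>z. cauchy_transform M h' z + poly P' z) \<in> O[at_infinity](\<lambda>z. 1 / z ^ (p + 1))"
  proof (rule landau_o.big.cong_ex)
    show "\<forall>\<^sub>F z in at_infinity. z * (cauchy_transform M h z + poly P z)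
        = cauchy_transform M h' z + poly P' z"
      using eventually_off
    proof eventually_elim
      case (elim z)
      show ?case
        unfolding distrib_left cauchy_transform_times[OF Suc.prems(1) elim] h'_def P'_def by simp
    qed
    have "\<forall>\<^sub>F z :: complex in at_infinity. norm z \<ge> 1"
      by (rule eventually_at_infinityI[of 1]) auto
    then show "\<forall>\<^sub>F z :: complex in at_infinity. z * (1 / z ^ (Suc p + 1)) = 1 / z ^ (p + 1)"
      by eventually_elim auto
  qed
  finally have decay: "(\<lambda>z. cauchy_transform M h' z + poly P' z) \<in> O[at_infinity](\<lambda>z. 1 / z ^ (p + 1))" .
  have "((\<lambda>z. cauchy_transform M h' z + poly P' z) \<longlongrightarrow> 0) at_infinity"
  proof -
    obtain c where c: "\<forall>\<^sub>F z in at_infinity.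
        norm (cauchy_transform M h' z + poly P' z) \<le> c * norm (1 / z ^ (p + 1))"
      using decay by (elim landau_o.bigE)
    have "((\<lambda>z::complex. c * norm (inverse z ^ (p + 1))) \<longlongrightarrow> c * norm ((0::complex) ^ (p + 1))) at_infinity"
      by (intro tendsto_intros tendsto_inverse_0)
    then have "((\<lambda>z::complex. c * norm (1 / z ^ (p + 1))) \<longlongrightarrow> 0) at_infinity"
      by (simp add: norm_divide norm_power norm_inverse divide_inverse power_inverse)
    with c show ?thesis by (rule Lim_null_comparison)
  qed
  then have "((\<lambda>z. (cauchy_transform M h' z + poly P' z) - cauchy_transform M h' z) \<longlongrightarrow> 0 - 0) at_infinity"
    by (intro tendsto_diff cauchy_transform_tendsto_0 h')
  \<comment> \<open>A polynomial tending to 0 at infinity is zero; its constant coefficient is the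
    zeroth moment of \<open>h\<close>.\<close>
  then have "P' = 0" by (intro poly_tendsto_0_at_infinity) simp
  then have zero: "(\<integral>x. h x \<partial>M) = 0" unfolding P'_def by simp
  show ?case
  proof (cases i)
    case (Suc j)
    then show ?thesis using Suc.IH[OF h' decay, of j] Suc.prems(3) unfolding h'_def
      by (simp add: mult_ac)
  qed (use zero in simp)
qed simp

end

section \<open>Extra vanishing moments after division by a polynomial\<close>

context compact_measure
begin

text \<open>Each linear factor \<open>z - a\<close> of \<open>W\<close> is a zero of the transform
  of \<open>h\<close>. Replacing \<open>h\<close> by \<open>g = h/(x-a)\<close> divides the
  transform by \<open>z - a\<close> and gains one vanishing moment, so the number of moments grows
  by \<open>degree W\<close> in total. Roots may be complex or multiple.\<close>

lemma moments_quotient: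
  assumes "weight D h" "continuous_on (- complex_of_real ` D) K" "W \<noteq> 0"
    and "\<And>z. z \<notin> complex_of_real ` D \<Longrightarrow> cauchy_transform M h z = poly W z * K z"
    and "\<And>x. x \<in> D \<Longrightarrow> poly W (complex_of_real x) \<noteq> 0"
    and "\<And>i. i < p \<Longrightarrow> (\<integral>x. h x * complex_of_real x ^ i \<partial>M) = 0"
    and "i < p + degree W"
  shows "(\<integral>x. h x / poly W (complex_of_real x) * complex_of_real x ^ i \<partial>M) = 0"
  using assms
proof (induction "degree W" arbitrary: W h p i)
  case 0
  then obtain c where c: "W = [:c:]" "c \<noteq> 0" by (metis degree_eq_zeroE pCons_eq_0_iff)
  have "(\<integral>x. h x / c * complex_of_real x ^ i \<partial>M) = (\<integral>x. 1 / c * (h x * complex_of_real x ^ i) \<partial>M)"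
    by simp
  also have "\<dots> = 0" unfolding integral_mult_right_zero using 0 by simp
  finally show ?case by (simp add: c)
next
  case (Suc n)
  note h = Suc.prems(1) and mom_h = Suc.prems(6)
  obtain a V where V: "W = [:-a, 1:] * V" "degree V = n"
    using complex_poly_split[of W n] Suc.hyps(2) by metis
  have a: "a \<notin> complex_of_real ` D" using Suc.prems(5) V by force
  have ne: "complex_of_real x - a \<noteq> 0" if "x \<in> D" for x using a that by auto
  define g where "g = (\<lambda>x. h x / (complex_of_real x - a))"
  have g_alt: "h x / (a - complex_of_real x) = -1 * g x" for x
    unfolding g_def by (simp add: minus_divide_right)
  have "g = (\<lambda>x. -1 * (h x / (a - complex_of_real x)))"
    unfolding g_alt by simp
  then have g: "weight D g"
    using weight_mult[OF weight_const weight_divide[OF compact_D h a], of "-1"] by simp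
  have "cauchy_transform M h a = 0" using Suc.prems(4)[OF a] V by simp
  then have hg: "cauchy_transform M h z = (z - a) * cauchy_transform M g z"
    if "z \<notin> complex_of_real ` D" for z
  proof -
    show ?thesis
      using cauchy_transform_diff[OF h that a] \<open>cauchy_transform M h a = 0\<close>
      unfolding g_alt cauchy_transform_cmult by (simp add: algebra_simps)
  qed
  \<comment> \<open>After cancelling \<open>z - a\<close> the identity is known only off
    \<open>a\<close>; continuity of both sides supplies the point \<open>a\<close>, where
    \<open>V\<close> may vanish again.\<close>
  have gV: "cauchy_transform M g z = poly V z * K z" if z: "z \<notin> complex_of_real ` D" for z
  proof (rule continuous_on_eq_off_finite[OF open_CD continuous_cauchy_transform[OF g], of _ "{a}"])
    show "continuous_on (- complex_of_real ` D) (\<lambda>z. poly V z * K z)"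
      by (intro continuous_intros Suc.prems(2))
    fix w assume w: "w \<in> - complex_of_real ` D" "w \<notin> {a}"
    then have "(w - a) * cauchy_transform M g w = (w - a) * (poly V w * K w)"
      using hg[of w] Suc.prems(4)[of w] by (simp add: V algebra_simps)
    then show "cauchy_transform M g w = poly V w * K w" using w by simp
  qed (use z in auto)
  \<comment> \<open>The zeroth moment of \<open>g\<close> is minus the transform of \<open>h\<close>
    at its zero \<open>a\<close>. The higher ones follow from \<open>x g = h + a g\<close>, which
    raises the exponent by one.\<close>
  have mom: "(\<integral>x. g x * complex_of_real x ^ i \<partial>M) = 0" if "i < Suc p" for i
    using that
  proof (induction i)
    case 0
    have "(\<integral>x. g x \<partial>M) = (\<integral>x. - (h x / (a - complex_of_real x)) \<partial>M)"
      unfolding g_alt by simp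
    also have "\<dots> = - cauchy_transform M h a"
      unfolding cauchy_transform_def by simp
    finally show ?case using \<open>cauchy_transform M h a = 0\<close> by simp
  next
    case (Suc i)
    have "(\<integral>x. g x * complex_of_real x ^ Suc i \<partial>M)
        = (\<integral>x. h x * complex_of_real x ^ i + a * (g x * complex_of_real x ^ i) \<partial>M)"
    proof (rule integral_cong_D)
      fix x assume "x \<in> D"
      then have hx: "h x = g x * (complex_of_real x - a)" using ne unfolding g_def by simp
      show "g x * complex_of_real x ^ Suc i
          = h x * complex_of_real x ^ i + a * (g x * complex_of_real x ^ i)"
        unfolding hx by (simp add: algebra_simps)
    qed (use g h in \<open>auto simp: weight_def\<close>)
    also have "\<dots> = (\<integral>x. h x * complex_of_real x ^ i \<partial>M) + (\<integral>x. a * (g x * complex_of_real x ^ i) \<partial>M)"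
      by (intro Bochner_Integration.integral_add weight_integrable weight_mult[OF weight_const]
          weight_of_real_mult compact_D g h)
    also have "\<dots> = 0"
      unfolding integral_mult_right_zero using Suc mom_h[of i] by simp
    finally show ?case .
  qed
  have "(\<integral>x. g x / poly V (complex_of_real x) * complex_of_real x ^ i \<partial>M) = 0"
  proof (rule Suc.hyps(1)[OF V(2)[symmetric] g Suc.prems(2) _ gV _ mom])
    show "V \<noteq> 0" using Suc.prems(3) V by auto
    show "poly V (complex_of_real x) \<noteq> 0" if "x \<in> D" for x
      using Suc.prems(5)[OF that] V by auto
    show "i < Suc p + degree V" using Suc.prems(7) Suc.hyps(2) V(2) by simp
  qed auto
  moreover have "poly W (complex_of_real x) = (complex_of_real x - a) * poly V (complex_of_real x)" for x
    by (simp add: V algebra_simps)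
  ultimately show ?case unfolding g_def by simp
qed

end

section \<open>Orthogonality and sign changes for measures of infinite support\<close>

locale infinite_compact_measure = compact_measure +
  assumes infinite_supp: "infinite (msupp M)" and supp_D: "msupp M \<subseteq> D"
begin

lemma D_nonempty: "D \<noteq> {}"
  using infinite_supp supp_D by auto

text \<open>If \<open>f x\<close> were nonzero, continuity would keep \<open>f\<close> nonzero on
  \<open>D\<close> near \<open>x\<close>, so a whole ball around the support point \<open>x\<close>
  would be null.\<close>

lemma zero_on_supp:
  assumes "continuous_on D f" "AE x in M. f x = (0::real)" "x \<in> msupp M"
  shows "f x = 0"
proof (rule ccontr)
  assume nz: "f x \<noteq> 0"
  have x: "x \<in> D" using assms(3) supp_D by auto
  obtain d where d: "d > 0" "\<And>y. y \<in> D \<Longrightarrow> dist y x < d \<Longrightarrow> dist (f y) (f x) < \<bar>f x\<bar>"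
    using assms(1) x nz unfolding continuous_on_iff by (metis zero_less_abs_iff)
  have "AE y in M. y \<notin> ball x d"
    using AE_D assms(2)
  proof eventually_elim
    case (elim y)
    then show ?case using d(2)[of y] by (auto simp: dist_commute)
  qed
  then have "emeasure M (ball x d) = 0"
    using sets_M by (subst (asm) AE_iff_measurable[of "ball x d"]) (auto simp: sets_eq_imp_space_eq[OF sets_M])
  then show False using assms(3) d(1) unfolding msupp_def by auto
qed

text \<open>With fewer sign changes there would be \<open>q\<close> of degree below \<open>N\<close>
  with \<open>h q \<ge> 0\<close> on \<open>D\<close>. Orthogonality makes the integral of
  \<open>h r q\<close> zero although the integrand has constant sign, so it vanishes on the infinite
  support, while \<open>h\<close> and \<open>q\<close> have only finitely many zeros in
  \<open>D\<close>.\<close>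

lemma orthogonal_sign_changes:
  fixes h r :: "real \<Rightarrow> real"
  assumes h: "h \<in> borel_measurable borel" "continuous_on D h"
    and r: "r \<in> borel_measurable borel" "continuous_on D r"
      "(\<forall>x\<in>D. 0 < r x) \<or> (\<forall>x\<in>D. r x < 0)"
    and orth: "\<And>i. i < N \<Longrightarrow> (\<integral>x. h x * r x * x ^ i \<partial>M) = 0"
    and fin: "finite {x\<in>D. h x = 0}"
  shows "sign_changes_ge h D N"
proof (rule ccontr)
  assume "\<not> sign_changes_ge h D N"
  then obtain q where q: "q \<noteq> 0" "degree q < N" "\<And>x. x \<in> D \<Longrightarrow> 0 \<le> h x * poly q x"
    using sign_matching_poly[OF _ D_nonempty, of h N] by metis
  \<comment> \<open>Normalises the constant sign of the weight \<open>r\<close>, so that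
    \<open>s r\<close> is positive on \<open>D\<close>.\<close>
  define s :: real where "s = (if \<forall>x\<in>D. 0 < r x then 1 else -1)"
  have s: "s * r x > 0" if "x \<in> D" for x using r(3) that unfolding s_def by auto
  define f where "f = (\<lambda>x. s * (h x * r x * poly q x))"
  have f_bor: "f \<in> borel_measurable borel"
    unfolding f_def using h r by (intro borel_measurable_times borel_measurable_const
        borel_measurable_continuous_onI[of "poly q"] continuous_intros) auto
  have f_cont: "continuous_on D f"
    unfolding f_def using h r by (intro continuous_intros)
  have int: "integrable M g" if "g \<in> borel_measurable borel" "continuous_on D g" for g :: "real \<Rightarrow> real"
  proof -
    have "bounded (g ` D)"
      by (intro compact_imp_bounded compact_continuous_image[OF that(2) compact_D])
    then obtain B where "\<And>x. x \<in> D \<Longrightarrow> norm (g x) \<le> B"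
      unfolding bounded_iff by auto
    then have "AE x in M. norm (g x) \<le> B" using AE_D by auto
    moreover have "g \<in> borel_measurable M" using that(1) sets_M by (simp cong: measurable_cong_sets)
    ultimately show ?thesis by (rule integrable_const_bound)
  qed
  have "(\<integral>x. f x \<partial>M) = (\<integral>x. (\<Sum>i\<le>degree q. s * coeff q i * (h x * r x * x ^ i)) \<partial>M)"
    unfolding f_def by (simp add: poly_altdef sum_distrib_left mult_ac)
  also have "\<dots> = (\<Sum>i\<le>degree q. (\<integral>x. s * coeff q i * (h x * r x * x ^ i) \<partial>M))"
    using h r by (intro Bochner_Integration.integral_sum int)
      (auto intro!: continuous_intros borel_measurable_times)
  also have "\<dots> = 0"
    unfolding integral_mult_right_zero using orth q(2) by simp
  finally have "(\<integral>x. f x \<partial>M) = 0" .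
  moreover have nonneg: "0 \<le> f x" if "x \<in> D" for x
  proof -
    have "0 \<le> (s * r x) * (h x * poly q x)"
      using s[OF that] q(3)[OF that] by - (rule mult_nonneg_nonneg, auto)
    then show ?thesis unfolding f_def by (simp add: mult_ac)
  qed
  moreover have "AE x in M. 0 \<le> f x" using AE_D nonneg by auto
  ultimately have "AE x in M. f x = 0"
    using integral_nonneg_eq_0_iff_AE[OF int[OF f_bor f_cont]] by simp
  then have zero: "f x = 0" if "x \<in> msupp M" for x
    using zero_on_supp[OF f_cont _ that] by simp
  have "msupp M \<subseteq> {x\<in>D. h x = 0} \<union> {x. poly q x = 0}"
  proof
    fix x assume x: "x \<in> msupp M"
    then have "x \<in> D" using supp_D by auto
    then show "x \<in> {x\<in>D. h x = 0} \<union> {x. poly q x = 0}"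
      using zero[OF x] s[of x] unfolding f_def by auto
  qed
  then show False using fin poly_roots_finite[OF q(1)] infinite_supp finite_subset by blast
qed

end

section \<open>Support of a measure and interchange of Cauchy transforms\<close>

lemma AE_msupp:
  assumes "sets M = sets borel"
  shows "AE x in M. x \<in> msupp M"
proof -
  have "\<exists>e>0. emeasure M (ball x e) = 0" if "x \<notin> msupp M" for x
    using that unfolding msupp_def by (auto simp: zero_less_iff_neq_zero)
  then obtain e where e: "\<And>x. x \<notin> msupp M \<Longrightarrow> e x > 0 \<and> emeasure M (ball x (e x)) = 0"
    by metis
  define F where "F = (\<lambda>x. ball x (e x)) ` (- msupp M)"
  have "\<And>S. S \<in> F \<Longrightarrow> open S" unfolding F_def by auto
  \<comment> \<open>The null balls covering the complement of the support are uncountably many in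
    general; the Lindelof property reduces them to countably many null sets.\<close>
  then obtain F' where F': "F' \<subseteq> F" "countable F'" "\<Union>F' = \<Union>F"
    by (rule Lindelof)
  have "AE x in M. \<forall>S\<in>F'. x \<notin> S"
  proof (subst AE_ball_countable[OF F'(2)], intro ballI)
    fix S assume "S \<in> F'"
    then have "open S" "emeasure M S = 0" using F'(1) e unfolding F_def by auto
    then show "AE x in M. x \<notin> S"
      using assms by (subst AE_iff_measurable[of S]) (auto simp: sets_eq_imp_space_eq[OF assms])
  qed
  then show ?thesis
  proof eventually_elim
    case (elim x)
    show ?case
    proof (rule ccontr)
      assume x: "x \<notin> msupp M"
      then have "x \<in> \<Union>F" using e[OF x] unfolding F_def by (intro UnionI[of "ball x (e x)"]) auto
      then show False using elim F'(3) by blast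
    qed
  qed
qed

lemma in_class_M_infinite_compact_measure:
  assumes "in_class_M M D"
  shows "infinite_compact_measure M D"
proof -
  have *: "sets M = sets borel" "finite_measure M" "compact (msupp M)" "infinite (msupp M)"
      "convex hull (msupp M) = D"
    using assms unfolding in_class_M_def by auto
  interpret finite_measure M by fact
  have sub: "msupp M \<subseteq> D" unfolding *(5)[symmetric] by (rule hull_subset)
  show ?thesis
  proof
    show "compact D" unfolding *(5)[symmetric] by (rule compact_convex_hull[OF *(3)])
    show "AE x in M. x \<in> D" using AE_msupp[OF *(1)] by (rule eventually_mono) (use sub in blast)
    show "sets M = sets borel" by fact
    show "infinite (msupp M)" by fact
    show "msupp M \<subseteq> D" by fact
  qed
qed

text \<open>Fubini for the kernel \<open>1/(x-t)\<close>, which is bounded because the disjoint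
  compact sets have positive distance. The minus sign comes from
  \<open>1/(x-t) = - 1/(t-x)\<close>.\<close>

lemma cauchy_transform_swap:
  assumes "compact_measure M D" "compact_measure N E" "D \<inter> E = {}" "weight D f" "weight E g"
  shows "(\<integral>x. g x * cauchy_transform M f (complex_of_real x) \<partial>N)
       = - (\<integral>t. f t * cauchy_transform N g (complex_of_real t) \<partial>M)"
proof -
  interpret M: compact_measure M D by fact
  interpret N: compact_measure N E by fact
  interpret P: pair_sigma_finite M N ..
  interpret PF: finite_measure "M \<Otimes>\<^sub>M N"
    by (rule finite_measure_pair_measure) unfold_locales
  define k where "k = (\<lambda>t x. g x * f t / (complex_of_real x - complex_of_real t))"
  have [measurable]: "f \<in> borel_measurable M" "g \<in> borel_measurable N"
    using assms M.weight_measurable N.weight_measurable by auto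
  have [measurable]: "complex_of_real \<in> borel_measurable M" "complex_of_real \<in> borel_measurable N"
    by (intro M.weight_measurable N.weight_measurable weight_poly[of _ "[:0,1:]", simplified]
        M.compact_D N.compact_D)+
  have k_meas: "case_prod k \<in> borel_measurable (M \<Otimes>\<^sub>M N)"
    unfolding k_def by measurable
  obtain B where B: "B > 0" "\<And>t. t \<in> D \<Longrightarrow> norm (f t) \<le> B"
    using assms(4) unfolding weight_def bounded_pos by auto
  obtain C where C: "C > 0" "\<And>t. t \<in> E \<Longrightarrow> norm (g t) \<le> C"
    using assms(5) unfolding weight_def bounded_pos by auto
  obtain \<delta> where \<delta>: "\<delta> > 0" "\<And>t x. t \<in> D \<Longrightarrow> x \<in> E \<Longrightarrow> \<delta> \<le> dist t x"
    using separate_compact_closed[OF M.compact_D compact_imp_closed[OF N.compact_D] assms(3)] by blast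
  have bound: "norm (k t x) \<le> C * B / \<delta>" if "t \<in> D" "x \<in> E" for t x
    unfolding k_def norm_divide norm_mult
  proof (intro frac_le mult_mono)
    have "norm (complex_of_real x - complex_of_real t) = dist t x"
      by (metis dist_commute dist_norm norm_of_real of_real_diff real_norm_def)
    then show "\<delta> \<le> norm (complex_of_real x - complex_of_real t)" using \<delta>(2)[OF that] by simp
  qed (use B C \<delta> that in auto)
  have "AE p in M \<Otimes>\<^sub>M N. fst p \<in> D \<and> snd p \<in> E"
  proof (rule P.AE_pair_measure)
    show "{p \<in> space (M \<Otimes>\<^sub>M N). fst p \<in> D \<and> snd p \<in> E} \<in> sets (M \<Otimes>\<^sub>M N)"
    proof -
      have "{p \<in> space (M \<Otimes>\<^sub>M N). fst p \<in> D \<and> snd p \<in> E} = D \<times> E"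
        by (auto simp: space_pair_measure sets_eq_imp_space_eq[OF M.sets_M] sets_eq_imp_space_eq[OF N.sets_M])
      moreover have "D \<in> sets M" "E \<in> sets N"
        using M.compact_D N.compact_D by (auto simp: M.sets_M N.sets_M compact_imp_closed)
      ultimately show ?thesis by simp
    qed
    show "AE t in M. AE x in N. fst (t, x) \<in> D \<and> snd (t, x) \<in> E"
      using M.AE_D N.AE_D by (auto elim!: eventually_mono)
  qed
  then have "AE p in M \<Otimes>\<^sub>M N. norm (case_prod k p) \<le> C * B / \<delta>"
    by eventually_elim (use bound in auto)
  then have int: "integrable (M \<Otimes>\<^sub>M N) (case_prod k)"
    using k_meas by (rule PF.integrable_const_bound)
  have "(\<integral>x. g x * cauchy_transform M f (complex_of_real x) \<partial>N) = (\<integral>x. (\<integral>t. k t x \<partial>M) \<partial>N)"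
    unfolding cauchy_transform_def k_def by (simp flip: times_divide_eq_right)
  also have "\<dots> = (\<integral>t. (\<integral>x. k t x \<partial>N) \<partial>M)"
    by (rule P.Fubini_integral[OF int])
  also have "\<dots> = (\<integral>t. - (f t * cauchy_transform N g (complex_of_real t)) \<partial>M)"
  proof (rule Bochner_Integration.integral_cong[OF refl])
    fix t
    have "k t x = - f t * (g x / (complex_of_real t - complex_of_real x))" for x
    proof -
      have "complex_of_real x - complex_of_real t = - (complex_of_real t - complex_of_real x)" by simp
      then show ?thesis unfolding k_def by (simp only: minus_divide_right[symmetric]) (simp add: mult.commute)
    qed
    then show "(\<integral>x. k t x \<partial>N) = - (f t * cauchy_transform N g (complex_of_real t))"
      unfolding cauchy_transform_def by (simp only: integral_mult_right_zero) simp
  qed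
  finally show ?thesis by simp
qed

section \<open>Nikishin systems\<close>

lemma poly_of_real_hom: "poly (map_poly complex_of_real w) (complex_of_real x) = complex_of_real (poly w x)"
  by (induction w) (auto simp: map_poly_pCons)

lemma map_poly_of_real_mult:
  "map_poly complex_of_real (p * q) = map_poly complex_of_real p * map_poly complex_of_real q"
  by (rule poly_eqI) (simp add: coeff_map_poly coeff_mult)

lemma map_poly_of_real_prod:
  "map_poly complex_of_real (prod f A) = (\<Prod>a\<in>A. map_poly complex_of_real (f a))"
  by (induction A rule: infinite_finite_induct) (auto simp: map_poly_of_real_mult)

lemma map_poly_of_real_eq_0: "map_poly complex_of_real w = 0 \<longleftrightarrow> w = 0"
  by (subst map_poly_eq_0_iff) auto

lemma degree_map_poly_of_real: "degree (map_poly complex_of_real w) = degree w"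
  by (rule degree_map_poly) auto

lemma poly_of_real_cnj:
  "poly (map_poly complex_of_real w) (cnj z) = cnj (poly (map_poly complex_of_real w) z)"
  by (induction w) (auto simp: map_poly_pCons)

lemma poly_constant_sign:
  fixes w :: "real poly"
  assumes "is_interval I" "\<And>x. x \<in> I \<Longrightarrow> poly w x \<noteq> 0"
  shows "(\<forall>x\<in>I. 0 < poly w x) \<or> (\<forall>x\<in>I. poly w x < 0)"
proof (rule ccontr)
  assume "\<not> ?thesis"
  then obtain a b where ab: "a \<in> I" "b \<in> I" "poly w a < 0" "0 < poly w b"
    using assms(2) by (meson linorder_neqE_linordered_idom)
  have "connected (poly w ` I)"
    by (intro connected_continuous_image continuous_intros) (use assms(1) is_interval_connected in blast)
  then have "0 \<in> poly w ` I"
    using connectedD_interval[OF _ imageI[OF ab(1)] imageI[OF ab(2)], of "poly w" 0] ab by simp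
  then show False using assms(2) by auto
qed

text \<open>Zeros are counted through polynomial divisors, so multiplicities are included. Real
  divisors give a real weight \<open>1/w\<close> on the line; nonreal zeros enter as conjugate
  pairs.\<close>

definition real_divides :: "complex set \<Rightarrow> real poly \<Rightarrow> (complex \<Rightarrow> complex) \<Rightarrow> bool" where
  "real_divides S w F \<longleftrightarrow> (\<exists>K. K holomorphic_on S \<and> (\<forall>z\<in>S. F z = poly (map_poly complex_of_real w) z * K z))"

lemma real_divides_zeros:
  assumes "F holomorphic_on S" "open S" "finite X" "complex_of_real ` X \<subseteq> S"
    and "\<And>x. x \<in> X \<Longrightarrow> F (complex_of_real x) = 0"
  shows "real_divides S (\<Prod>x\<in>X. [:-x, 1:]) F"
proof -
  have "\<exists>K. K holomorphic_on S \<and>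
      (\<forall>z\<in>S. F z = poly (\<Prod>a\<in>complex_of_real ` X. [:-a, 1:]) z * K z)"
    using assms by (intro holomorphic_divide_zeros) auto
  moreover have "(\<Prod>a\<in>complex_of_real ` X. [:-a, 1:]) = map_poly complex_of_real (\<Prod>x\<in>X. [:-x, 1:])"
    by (subst prod.reindex) (auto simp: map_poly_of_real_prod map_poly_pCons inj_on_def)
  ultimately show ?thesis unfolding real_divides_def by simp
qed

lemma degree_prod_linear: "finite X \<Longrightarrow> degree (\<Prod>x\<in>X. [:-x, 1::real:]) = card X"
  by (subst degree_prod_eq_sum_degree) auto

lemma prod_linear_nonzero: "finite X \<Longrightarrow> (\<Prod>x\<in>X. [:-x, 1::real:]) \<noteq> 0"
  by auto

lemma poly_prod_linear_nonzero:
  "finite X \<Longrightarrow> x \<notin> X \<Longrightarrow> poly (\<Prod>x\<in>X. [:-x, 1::real:]) x \<noteq> 0"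
  by (auto simp: poly_prod)

lemma cauchy_transform_measurable:
  assumes "sigma_finite_measure M" "sets M = sets borel" "h \<in> borel_measurable borel"
  shows "cauchy_transform M h \<in> borel_measurable borel"
proof -
  interpret sigma_finite_measure M by fact
  note [measurable_cong] = assms(2)
  note [measurable] = assms(3)
  show ?thesis unfolding cauchy_transform_def by measurable
qed

section \<open>The functions of a Nikishin system and their regularity\<close>

locale nikishin =
  fixes m :: nat and sig :: "nat \<Rightarrow> real measure" and eps :: "nat \<Rightarrow> real" and D :: "nat \<Rightarrow> real set"
  assumes measures: "\<And>j. j \<in> {1..m} \<Longrightarrow> infinite_compact_measure (sig j) (D j)"
    and intervals: "\<And>j. j \<in> {1..m} \<Longrightarrow> is_interval (D j)"
    and disjoint: "\<And>j. 1 \<le> j \<Longrightarrow> j < m \<Longrightarrow> D j \<inter> D (Suc j) = {}"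
    and sign: "\<And>j. j \<in> {1..m} \<Longrightarrow> eps j = 1 \<or> eps j = -1"
begin

text \<open>\<open>D 0\<close> is left arbitrary by the locale; the empty cut at level 0 reflects
  that the function there is a polynomial.\<close>

definition cut :: "nat \<Rightarrow> real set" where "cut k = (if k = 0 then {} else D k)"

definition Psi_dom :: "nat \<Rightarrow> complex set" where "Psi_dom k = - complex_of_real ` cut k"

text \<open>The density of \<open>s\<^bsub>j,j+d\<^esub>\<close> with respect to \<open>\<sigma>\<^sub>j\<close>.\<close>

definition nik_density :: "nat \<Rightarrow> nat \<Rightarrow> real \<Rightarrow> complex" where
  "nik_density d j x = (case d of 0 \<Rightarrow> 1 | Suc e \<Rightarrow> nik_aux sig eps e (Suc j) (complex_of_real x))"

abbreviation psi :: "real poly \<Rightarrow> nat \<Rightarrow> real \<Rightarrow> complex" where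
  "psi Q k x \<equiv> Psi sig eps Q k (complex_of_real x)"

abbreviation H :: "nat \<Rightarrow> (real \<Rightarrow> complex) \<Rightarrow> complex \<Rightarrow> complex" where
  "H j \<equiv> cauchy_transform (sig j)"

lemma measure_j: "1 \<le> j \<Longrightarrow> j \<le> m \<Longrightarrow> compact_measure (sig j) (D j)"
  using measures[of j] by (simp add: infinite_compact_measure_def)

lemma cut_Suc [simp]: "cut (Suc k) = D (Suc k)"
  by (simp add: cut_def)

lemma cut_disjoint: "k < m \<Longrightarrow> cut k \<inter> D (Suc k) = {}"
  using disjoint[of k] by (auto simp: cut_def)

lemma D_in_Psi_dom: "k < m \<Longrightarrow> x \<in> D (Suc k) \<Longrightarrow> complex_of_real x \<in> Psi_dom k"
  using cut_disjoint[of k] by (auto simp: Psi_dom_def)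

lemma open_Psi_dom:
  assumes "k \<le> m"
  shows "open (Psi_dom k)"
proof (cases k)
  case 0
  then show ?thesis by (simp add: Psi_dom_def cut_def)
next
  case (Suc j)
  then interpret compact_measure "sig k" "D k" using measure_j[of k] assms by simp
  show ?thesis using open_CD by (simp add: Psi_dom_def Suc)
qed

lemma nik_aux_eq: "nik_aux sig eps d j z = complex_of_real (eps j) * H j (nik_density d j) z"
  by (cases d) (auto simp: cauchy_transform_def nik_density_def)

lemma Psi_Suc_eq: "Psi sig eps Q (Suc k) z = complex_of_real (eps (Suc k)) * H (Suc k) (psi Q k) z"
  by (simp add: cauchy_transform_def)

lemma H_measurable:
  assumes "1 \<le> j" "j \<le> m" "h \<in> borel_measurable borel"
  shows "H j h \<in> borel_measurable borel"
proof -
  interpret compact_measure "sig j" "D j" using measure_j assms by simp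
  show ?thesis using sets_M assms(3) by (intro cauchy_transform_measurable) unfold_locales
qed

text \<open>For \<open>d > 0\<close> the density is, up to sign, a Cauchy transform over the next
  interval. That interval is disjoint from \<open>D j\<close>, so the density is continuous on the
  compact set \<open>D j\<close>.\<close>

lemma weight_nik_density:
  assumes "1 \<le> j" "j + d \<le> m"
  shows "weight (D j) (nik_density d j)"
  using assms
proof (induction d arbitrary: j)
  case 0
  then show ?case by (simp add: nik_density_def weight_const)
next
  case (Suc d)
  interpret J: compact_measure "sig j" "D j" using measure_j Suc.prems by simp
  interpret J': compact_measure "sig (Suc j)" "D (Suc j)" using measure_j[of "Suc j"] Suc.prems by simp
  have w: "weight (D (Suc j)) (nik_density d (Suc j))" using Suc.IH[of "Suc j"] Suc.prems by simp
  have eq: "nik_density (Suc d) j = (\<lambda>x. complex_of_real (eps (Suc j)) * H (Suc j) (nik_density d (Suc j)) (complex_of_real x))"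
    by (rule ext) (simp add: nik_density_def nik_aux_eq)
  show ?case
  proof (rule weight_continuous[OF J.compact_D])
    have "H (Suc j) (nik_density d (Suc j)) \<in> borel_measurable borel"
      using w Suc.prems by (intro H_measurable) (auto simp: weight_def)
    then show "nik_density (Suc d) j \<in> borel_measurable borel"
      unfolding eq by measurable
    have "continuous_on (D j) (\<lambda>x. H (Suc j) (nik_density d (Suc j)) (complex_of_real x))"
      using disjoint[of j] Suc.prems
      by (intro continuous_on_compose2[OF J'.continuous_cauchy_transform[OF w]] continuous_intros) auto
    then show "continuous_on (D j) (nik_density (Suc d) j)"
      unfolding eq by (intro continuous_intros)
  qed
qed

text \<open>The three claims are proved together: boundedness of level \<open>k\<close> on
  \<open>D (Suc k)\<close> makes level \<open>k + 1\<close> a well-behaved Cauchy transform, and its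
  continuity off that interval bounds it on the following one.\<close>

lemma Psi_properties:
  assumes "k \<le> m"
  shows "Psi sig eps Q k \<in> borel_measurable borel" "Psi sig eps Q k holomorphic_on Psi_dom k"
    "k < m \<Longrightarrow> weight (D (Suc k)) (psi Q k)"
proof -
  have "Psi sig eps Q k \<in> borel_measurable borel \<and> Psi sig eps Q k holomorphic_on Psi_dom k
      \<and> (k < m \<longrightarrow> weight (D (Suc k)) (psi Q k))"
    using assms
  proof (induction k)
    case 0
    have P: "Psi sig eps Q 0 = poly (map_poly complex_of_real Q)" by (rule ext) simp
    have "weight (D (Suc 0)) (psi Q 0)" if "0 < m"
      using compact_measure.compact_D[OF measure_j[of "Suc 0"]] that unfolding P
      by (intro weight_poly) auto
    then show ?case unfolding P
      by (auto intro!: borel_measurable_continuous_onI continuous_intros holomorphic_intros)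
  next
    case (Suc k)
    interpret J: compact_measure "sig (Suc k)" "D (Suc k)" using measure_j[of "Suc k"] Suc.prems by simp
    have w: "weight (D (Suc k)) (psi Q k)" using Suc by simp
    have P: "Psi sig eps Q (Suc k) = (\<lambda>z. complex_of_real (eps (Suc k)) * H (Suc k) (psi Q k) z)"
      by (rule ext) (rule Psi_Suc_eq)
    have "H (Suc k) (psi Q k) \<in> borel_measurable borel"
      using w Suc.prems by (intro H_measurable) (auto simp: weight_def)
    then have meas: "Psi sig eps Q (Suc k) \<in> borel_measurable borel"
      unfolding P by measurable
    have hol: "Psi sig eps Q (Suc k) holomorphic_on Psi_dom (Suc k)"
      unfolding P Psi_dom_def cut_Suc by (intro holomorphic_intros J.holomorphic_cauchy_transform w)
    have "weight (D (Suc (Suc k))) (psi Q (Suc k))" if "Suc k < m"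
    proof (rule weight_continuous)
      show "compact (D (Suc (Suc k)))"
        using compact_measure.compact_D[OF measure_j[of "Suc (Suc k)"]] that by simp
      show "psi Q (Suc k) \<in> borel_measurable borel"
        using meas by measurable
      show "continuous_on (D (Suc (Suc k))) (psi Q (Suc k))"
        using D_in_Psi_dom[OF that]
        by (intro continuous_on_compose2[OF holomorphic_on_imp_continuous_on[OF hol]] continuous_intros) auto
    qed
    then show ?case using meas hol by blast
  qed
  then show "Psi sig eps Q k \<in> borel_measurable borel" "Psi sig eps Q k holomorphic_on Psi_dom k"
    "k < m \<Longrightarrow> weight (D (Suc k)) (psi Q k)" by blast+
qed

lemma psi_measurable:
  assumes "k \<le> m"
  shows "psi Q k \<in> borel_measurable borel"
proof -
  note [measurable] = Psi_properties(1)[OF assms]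
  show ?thesis by measurable
qed

lemma continuous_psi:
  assumes "k < m"
  shows "continuous_on (D (Suc k)) (psi Q k)"
  using D_in_Psi_dom[OF assms] assms
  by (intro continuous_on_compose2[OF holomorphic_on_imp_continuous_on[OF Psi_properties(2)[of k]]]
      continuous_intros) auto

text \<open>Conjugation commutes with the integral also where the integrand is not integrable, the
  default value 0 being real. So the symmetry holds on the cut as well.\<close>

lemma Psi_cnj: "Psi sig eps Q k (cnj z) = cnj (Psi sig eps Q k z)"
proof (induction k arbitrary: z)
  case 0
  then show ?case by (simp add: poly_of_real_cnj)
next
  case (Suc k)
  have eq: "cnj (psi Q k x / (z - complex_of_real x)) = psi Q k x / (cnj z - complex_of_real x)" for x
    using Suc[of "complex_of_real x"] by simp
  have "cnj (H (Suc k) (psi Q k) z) = H (Suc k) (psi Q k) (cnj z)"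
    unfolding cauchy_transform_def Bochner_Integration.integral_cnj[symmetric] eq ..
  then show ?case unfolding Psi_Suc_eq by simp
qed

lemma psi_real: "complex_of_real (Re (psi Q k x)) = psi Q k x"
  using Psi_cnj[of Q k "complex_of_real x"] by (simp add: complex_eq_iff)

lemma Psi_linear:
  assumes "k \<le> m" "z \<in> Psi_dom k"
  shows "Psi sig eps (smult a P + smult b Q) k z
       = complex_of_real a * Psi sig eps P k z + complex_of_real b * Psi sig eps Q k z"
  using assms
proof (induction k arbitrary: z)
  case 0
  have "map_poly complex_of_real (smult a P + smult b Q)
      = smult (complex_of_real a) (map_poly complex_of_real P) + smult (complex_of_real b) (map_poly complex_of_real Q)"
    by (rule poly_eqI) (simp add: coeff_map_poly)
  then show ?case by simp
next
  case (Suc k)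
  interpret J: compact_measure "sig (Suc k)" "D (Suc k)" using measure_j[of "Suc k"] Suc.prems by simp
  have w: "weight (D (Suc k)) (psi Q k)" for Q using Suc.prems Psi_properties(3)[of k] by simp
  have z: "z \<notin> complex_of_real ` D (Suc k)" using Suc.prems by (simp add: Psi_dom_def)
  have wm: "psi Q k \<in> borel_measurable borel" for Q using w[of Q] by (simp add: weight_def)
  have "H (Suc k) (psi (smult a P + smult b Q) k) z
      = H (Suc k) (\<lambda>x. complex_of_real a * psi P k x + complex_of_real b * psi Q k x) z"
    unfolding cauchy_transform_def
  proof (rule J.integral_cong_D)
    fix x assume "x \<in> D (Suc k)"
    then show "psi (smult a P + smult b Q) k x / (z - complex_of_real x)
        = (complex_of_real a * psi P k x + complex_of_real b * psi Q k x) / (z - complex_of_real x)"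
      using Suc.IH[of "complex_of_real x"] D_in_Psi_dom[of k x] Suc.prems by simp
  qed (use wm in measurable)
  also have "\<dots> = complex_of_real a * H (Suc k) (psi P k) z + complex_of_real b * H (Suc k) (psi Q k) z"
    using z w by (subst J.cauchy_transform_add) (auto intro: weight_mult weight_const simp: J.cauchy_transform_cmult)
  finally show ?case unfolding Psi_Suc_eq by (simp add: algebra_simps)
qed

end

section \<open>Orthogonality, sign changes and divisors\<close>

context nikishin
begin

text \<open>Up to signs, these are the relations satisfied by level \<open>k\<close> for the tail
  system generated by the measures \<open>k + 1\<close> to \<open>m\<close>, the density standing
  for \<open>s\<close> with indices \<open>k+1, k+1+d\<close>. Sign counting uses
  \<open>d = 0\<close>; the relations with \<open>d > 0\<close> carry the passage to the next
  level.\<close>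

definition orth :: "(nat \<Rightarrow> nat) \<Rightarrow> real poly \<Rightarrow> nat \<Rightarrow> bool" where
  "orth p Q k \<longleftrightarrow> (\<forall>d i. k + 1 + d \<le> m \<longrightarrow> i < p (k + 1 + d) \<longrightarrow>
     (\<integral>x. psi Q k x * nik_density d (Suc k) x * complex_of_real x ^ i \<partial>sig (Suc k)) = 0)"

lemma orthD:
  assumes "orth p Q k" "k < m" "i < p (Suc k)"
  shows "(\<integral>x. psi Q k x * complex_of_real x ^ i \<partial>sig (Suc k)) = 0"
  using assms(1)[unfolded orth_def, rule_format, of 0 i] assms(2,3) by (simp add: nik_density_def)

text \<open>The product of \<open>Q\<close> and the transform equals the transform of the density
  times \<open>Q\<close> plus a polynomial, so the prescribed decay at infinity says exactly that
  moments vanish.\<close>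

lemma typeII_HP_orth:
  assumes "typeII_HP sig eps m p Q"
  shows "orth p Q 0"
  unfolding orth_def
proof (intro allI impI)
  fix d i assume d: "0 + 1 + d \<le> m" and i: "i < p (0 + 1 + d)"
  interpret J: compact_measure "sig 1" "D 1" using measure_j[of 1] d by simp
  let ?Q = "map_poly complex_of_real Q"
  let ?e = "complex_of_real (eps 1)"
  have e: "?e \<noteq> 0" using sign[of 1] d by auto
  have w: "weight (D 1) (nik_density d 1)" using weight_nik_density[of 1 d] d by simp
  have "\<exists>P. (\<lambda>z. poly ?Q z * nik_cauchy sig eps 1 (Suc d) z - poly P z)
      \<in> O[at_infinity](\<lambda>z. 1 / z ^ (p (Suc d) + 1))"
    using assms d unfolding typeII_HP_def by auto
  then obtain P where P: "(\<lambda>z. poly ?Q z * nik_cauchy sig eps 1 (Suc d) z - poly P z)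
      \<in> O[at_infinity](\<lambda>z. 1 / z ^ (p (Suc d) + 1))" by blast
  obtain R where R: "\<And>z. z \<notin> complex_of_real ` D 1 \<Longrightarrow> poly ?Q z * H 1 (nik_density d 1) z
      = H 1 (\<lambda>x. poly ?Q (complex_of_real x) * nik_density d 1 x) z + poly R z"
    using J.poly_times_cauchy_transform[OF w, of ?Q] by blast
  define h where "h = (\<lambda>x. ?e * (poly ?Q (complex_of_real x) * nik_density d 1 x))"
  have h: "weight (D 1) h"
    unfolding h_def by (intro weight_mult weight_const weight_poly J.compact_D w)
  have "(\<lambda>z. H 1 h z + poly (smult ?e R - P) z) \<in> O[at_infinity](\<lambda>z. 1 / z ^ (p (Suc d) + 1))
    \<longleftrightarrow> (\<lambda>z. poly ?Q z * nik_cauchy sig eps 1 (Suc d) z - poly P z)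
      \<in> O[at_infinity](\<lambda>z. 1 / z ^ (p (Suc d) + 1))"
  proof (rule landau_o.big.in_cong)
    show "\<forall>\<^sub>F z in at_infinity. H 1 h z + poly (smult ?e R - P) z
        = poly ?Q z * nik_cauchy sig eps 1 (Suc d) z - poly P z"
      using J.eventually_off
    proof eventually_elim
      case (elim z)
      have "poly ?Q z * nik_cauchy sig eps 1 (Suc d) z = ?e * (poly ?Q z * H 1 (nik_density d 1) z)"
        by (simp add: nik_cauchy_def nik_aux_eq)
      also have "\<dots> = H 1 h z + ?e * poly R z"
        unfolding R[OF elim] h_def J.cauchy_transform_cmult by (simp add: algebra_simps)
      finally show ?case by simp
    qed
  qed
  with P have "(\<lambda>z. H 1 h z + poly (smult ?e R - P) z) \<in> O[at_infinity](\<lambda>z. 1 / z ^ (p (Suc d) + 1))"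
    by blast
  then have "(\<integral>x. h x * complex_of_real x ^ i \<partial>sig 1) = 0"
    by (rule J.moments_of_decay[OF h]) (use i in simp)
  moreover have "(\<integral>x. h x * complex_of_real x ^ i \<partial>sig 1)
      = ?e * (\<integral>x. psi Q 0 x * nik_density d (Suc 0) x * complex_of_real x ^ i \<partial>sig (Suc 0))"
    unfolding h_def mult.assoc integral_mult_right_zero by simp
  ultimately show "(\<integral>x. psi Q 0 x * nik_density d (Suc 0) x * complex_of_real x ^ i \<partial>sig (Suc 0)) = 0"
    using e by simp
qed

text \<open>Fubini moves the inner transform onto the factor \<open>g\<close>. Its transform on
  \<open>D (Suc k)\<close> is, up to sign, the density with \<open>d + 1\<close> times
  \<open>x^i\<close> minus a polynomial of degree below \<open>i\<close>. The first part is killed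
  by the relation for \<open>d + 1\<close>, the polynomial by the relations for
  \<open>d = 0\<close>.\<close>

lemma orth_Suc:
  assumes "orth p Q k" "Suc k < m"
    and p: "\<And>i j. 1 \<le> i \<Longrightarrow> i < j \<Longrightarrow> j \<le> m \<Longrightarrow> p j \<le> p i + 1"
  shows "orth p Q (Suc k)"
  unfolding orth_def
proof (intro allI impI)
  fix d i assume d: "Suc k + 1 + d \<le> m" and i: "i < p (Suc k + 1 + d)"
  interpret J: compact_measure "sig (Suc k)" "D (Suc k)" using measure_j[of "Suc k"] assms by simp
  interpret J': compact_measure "sig (Suc (Suc k))" "D (Suc (Suc k))"
    using measure_j[of "Suc (Suc k)"] assms by simp
  let ?e = "complex_of_real (eps (Suc (Suc k)))"
  have e: "?e * ?e = 1" using sign[of "Suc (Suc k)"] d by auto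
  have wS: "weight (D (Suc (Suc k))) (nik_density d (Suc (Suc k)))" using weight_nik_density[of "Suc (Suc k)" d] d by simp
  have wS': "weight (D (Suc k)) (nik_density (Suc d) (Suc k))" using weight_nik_density[of "Suc k" "Suc d"] d by simp
  define g where "g = (\<lambda>x. nik_density d (Suc (Suc k)) x * complex_of_real x ^ i)"
  have wg: "weight (D (Suc (Suc k))) g"
    unfolding g_def by (intro weight_of_real_mult J'.compact_D wS)
  have wf: "weight (D (Suc k)) (psi Q k)" using Psi_properties(3)[of k] assms by simp
  obtain c where c: "\<And>z. z \<notin> complex_of_real ` D (Suc (Suc k)) \<Longrightarrow>
      z ^ i * H (Suc (Suc k)) (nik_density d (Suc (Suc k))) z = H (Suc (Suc k)) g z + (\<Sum>l<i. c l * z ^ l)"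
    using J'.power_times_cauchy_transform[OF wS, of i] unfolding g_def by blast
  have Hg: "H (Suc (Suc k)) g (complex_of_real t)
      = ?e * (nik_density (Suc d) (Suc k) t * complex_of_real t ^ i) - (\<Sum>l<i. c l * complex_of_real t ^ l)"
    if "t \<in> D (Suc k)" for t
  proof -
    have "complex_of_real t \<notin> complex_of_real ` D (Suc (Suc k))"
      using disjoint[of "Suc k"] assms(2) that by auto
    from c[OF this] have "H (Suc (Suc k)) g (complex_of_real t)
      = complex_of_real t ^ i * H (Suc (Suc k)) (nik_density d (Suc (Suc k))) (complex_of_real t)
        - (\<Sum>l<i. c l * complex_of_real t ^ l)" by (simp add: algebra_simps)
    moreover have "H (Suc (Suc k)) (nik_density d (Suc (Suc k))) (complex_of_real t) = ?e * nik_density (Suc d) (Suc k) t"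
    proof -
      have "nik_density (Suc d) (Suc k) t = ?e * H (Suc (Suc k)) (nik_density d (Suc (Suc k))) (complex_of_real t)"
        by (simp add: nik_density_def nik_aux_eq)
      then show ?thesis using e by (simp flip: mult.assoc)
    qed
    ultimately show ?thesis by (simp add: mult_ac)
  qed
  define F where "F = (\<lambda>t. psi Q k t * nik_density (Suc d) (Suc k) t * complex_of_real t ^ i)"
  have wF: "weight (D (Suc k)) F"
    unfolding F_def by (intro weight_of_real_mult weight_mult J.compact_D wf wS')
  have wG: "weight (D (Suc k)) (\<lambda>t. psi Q k t * complex_of_real t ^ l)" for l
    by (intro weight_of_real_mult J.compact_D wf)
  have F0: "(\<integral>t. F t \<partial>sig (Suc k)) = 0"
    using assms(1)[unfolded orth_def, rule_format, of "Suc d" i] d i unfolding F_def by simp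
  have G0: "(\<integral>t. psi Q k t * complex_of_real t ^ l \<partial>sig (Suc k)) = 0" if "l < i" for l
  proof (rule orthD[OF assms(1)])
    \<comment> \<open>Here the slack of one is absorbed: \<open>l < i\<close> and
      \<open>i < p (Suc k + 1 + d) \<le> p (Suc k) + 1\<close> still give
      \<open>l < p (Suc k)\<close>.\<close>
    show "l < p (Suc k)" using p[of "Suc k" "Suc k + 1 + d"] d i that by simp
  qed (use assms(2) in simp)
  have "(\<integral>x. g x * H (Suc k) (psi Q k) (complex_of_real x) \<partial>sig (Suc (Suc k)))
      = - (\<integral>t. psi Q k t * H (Suc (Suc k)) g (complex_of_real t) \<partial>sig (Suc k))"
    using disjoint[of "Suc k"] assms(2)
    by (intro cauchy_transform_swap[OF J.compact_measure_axioms J'.compact_measure_axioms _ wf wg]) auto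
  also have "(\<integral>t. psi Q k t * H (Suc (Suc k)) g (complex_of_real t) \<partial>sig (Suc k))
      = (\<integral>t. ?e * F t - (\<Sum>l<i. c l * (psi Q k t * complex_of_real t ^ l)) \<partial>sig (Suc k))"
  proof (rule J.integral_cong_D)
    have "H (Suc (Suc k)) g \<in> borel_measurable borel"
      using wg assms(2) by (intro H_measurable) (auto simp: weight_def)
    moreover have "psi Q k \<in> borel_measurable borel" using wf by (simp add: weight_def)
    ultimately show "(\<lambda>t. psi Q k t * H (Suc (Suc k)) g (complex_of_real t)) \<in> borel_measurable borel"
      by measurable
    have [measurable]: "F \<in> borel_measurable borel" "(\<lambda>t. psi Q k t * complex_of_real t ^ l) \<in> borel_measurable borel" for l
      using wF wG by (simp_all add: weight_def)
    show "(\<lambda>t. ?e * F t - (\<Sum>l<i. c l * (psi Q k t * complex_of_real t ^ l))) \<in> borel_measurable borel"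
      by measurable
    show "psi Q k t * H (Suc (Suc k)) g (complex_of_real t)
        = ?e * F t - (\<Sum>l<i. c l * (psi Q k t * complex_of_real t ^ l))" if "t \<in> D (Suc k)" for t
      unfolding Hg[OF that] F_def by (simp add: algebra_simps sum_distrib_left)
  qed
  also have "\<dots> = (\<integral>t. ?e * F t \<partial>sig (Suc k))
      - (\<integral>t. (\<Sum>l<i. c l * (psi Q k t * complex_of_real t ^ l)) \<partial>sig (Suc k))"
    by (intro Bochner_Integration.integral_diff Bochner_Integration.integrable_sum
        J.weight_integrable weight_mult weight_const wF wG)
  also have "(\<integral>t. (\<Sum>l<i. c l * (psi Q k t * complex_of_real t ^ l)) \<partial>sig (Suc k))
      = (\<Sum>l<i. (\<integral>t. c l * (psi Q k t * complex_of_real t ^ l) \<partial>sig (Suc k)))"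
    by (intro Bochner_Integration.integral_sum J.weight_integrable weight_mult[OF weight_const] wG)
  finally have zero: "(\<integral>x. g x * H (Suc k) (psi Q k) (complex_of_real x) \<partial>sig (Suc (Suc k))) = 0"
    unfolding integral_mult_right_zero using F0 G0 by simp
  have "(\<integral>x. psi Q (Suc k) x * nik_density d (Suc (Suc k)) x * complex_of_real x ^ i \<partial>sig (Suc (Suc k)))
      = (\<integral>x. complex_of_real (eps (Suc k)) * (g x * H (Suc k) (psi Q k) (complex_of_real x)) \<partial>sig (Suc (Suc k)))"
    unfolding Psi_Suc_eq g_def by (simp only: mult_ac)
  also have "\<dots> = 0" unfolding integral_mult_right_zero zero by simp
  finally show "(\<integral>x. psi Q (Suc k) x * nik_density d (Suc (Suc k)) x * complex_of_real x ^ i \<partial>sig (Suc (Suc k))) = 0" .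
qed

text \<open>Only the relations for \<open>d = 0\<close> are kept and no degree bound is imposed. The
  notion therefore applies equally to both Hermite--Pade polynomials and to their nonzero real
  combinations.\<close>

definition admissible :: "(nat \<Rightarrow> nat) \<Rightarrow> real poly \<Rightarrow> bool" where
  "admissible p Q \<longleftrightarrow> Q \<noteq> 0 \<and> (\<forall>k<m. \<forall>i<p (Suc k).
     (\<integral>x. psi Q k x * complex_of_real x ^ i \<partial>sig (Suc k)) = 0)"

lemma typeII_HP_admissible:
  assumes HP: "typeII_HP sig eps m p Q"
    and p: "\<And>i j. 1 \<le> i \<Longrightarrow> i < j \<Longrightarrow> j \<le> m \<Longrightarrow> p j \<le> p i + 1"
  shows "admissible p Q"
proof -
  have "orth p Q k" if "k < m" for k
    using that
  proof (induction k)
    case 0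
    show ?case by (rule typeII_HP_orth[OF HP])
  next
    case (Suc k)
    then show ?case using orth_Suc[of p Q k] p by simp
  qed
  then show ?thesis using HP orthD unfolding admissible_def typeII_HP_def by blast
qed

lemma admissible_linear:
  assumes P: "admissible p P" and Q: "admissible q Q" and "\<And>j. p j \<le> q j"
    and nz: "smult a P + smult b Q \<noteq> 0"
  shows "admissible p (smult a P + smult b Q)"
  unfolding admissible_def
proof (intro conjI allI impI nz)
  fix k i assume k: "k < m" and i: "i < p (Suc k)"
  interpret J: compact_measure "sig (Suc k)" "D (Suc k)" using measure_j[of "Suc k"] k by simp
  have w: "weight (D (Suc k)) (\<lambda>x. psi Q k x * complex_of_real x ^ i)" for Q
    using k by (intro weight_of_real_mult J.compact_D Psi_properties(3)) auto
  have "(\<integral>x. psi (smult a P + smult b Q) k x * complex_of_real x ^ i \<partial>sig (Suc k))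
      = (\<integral>x. complex_of_real a * (psi P k x * complex_of_real x ^ i)
            + complex_of_real b * (psi Q k x * complex_of_real x ^ i) \<partial>sig (Suc k))"
  proof (rule J.integral_cong_D)
    show "psi (smult a P + smult b Q) k x * complex_of_real x ^ i
        = complex_of_real a * (psi P k x * complex_of_real x ^ i)
            + complex_of_real b * (psi Q k x * complex_of_real x ^ i)" if "x \<in> D (Suc k)" for x
      using Psi_linear[OF _ D_in_Psi_dom[OF k that], of a P b Q] k by (simp add: algebra_simps)
    have [measurable]: "psi Q k \<in> borel_measurable borel" for Q using psi_measurable k by simp
    show "(\<lambda>x. psi (smult a P + smult b Q) k x * complex_of_real x ^ i) \<in> borel_measurable borel"
      by measurable
    show "(\<lambda>x. complex_of_real a * (psi P k x * complex_of_real x ^ i)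
            + complex_of_real b * (psi Q k x * complex_of_real x ^ i)) \<in> borel_measurable borel"
      by measurable
  qed
  also have "\<dots> = complex_of_real a * (\<integral>x. psi P k x * complex_of_real x ^ i \<partial>sig (Suc k))
            + complex_of_real b * (\<integral>x. psi Q k x * complex_of_real x ^ i \<partial>sig (Suc k))"
    by (subst Bochner_Integration.integral_add)
       (auto intro!: J.weight_integrable weight_mult[OF weight_const] w)
  also have "\<dots> = 0"
    using P Q k i assms(3)[of "Suc k"] unfolding admissible_def by simp
  finally show "(\<integral>x. psi (smult a P + smult b Q) k x * complex_of_real x ^ i \<partial>sig (Suc k)) = 0" .
qed

text \<open>Any finitely many distinct zeros form a divisor, so a degree bound for divisors bounds
  every finite subset. The bound is an assumption so that the lemma can already serve inside the
  induction that establishes such bounds.\<close>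

lemma finite_zeros:
  assumes k: "k < m"
    and U: "\<And>w. real_divides (Psi_dom k) w (Psi sig eps Q k) \<Longrightarrow> w \<noteq> 0 \<Longrightarrow>
      (\<And>x. x \<in> cut k \<Longrightarrow> poly w x \<noteq> 0) \<Longrightarrow> degree w \<le> b"
    and X: "X \<inter> cut k = {}" "\<And>x. x \<in> X \<Longrightarrow> psi Q k x = 0"
  shows "finite X \<and> card X \<le> b"
proof (rule finite_if_finite_subsets_card_bdd)
  fix Y assume Y: "Y \<subseteq> X" "finite Y"
  have div: "real_divides (Psi_dom k) (\<Prod>x\<in>Y. [:-x, 1:]) (Psi sig eps Q k)"
  proof (rule real_divides_zeros)
    show "Psi sig eps Q k holomorphic_on Psi_dom k" "open (Psi_dom k)"
      using Psi_properties(2)[of k] open_Psi_dom[of k] k by auto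
    show "complex_of_real ` Y \<subseteq> Psi_dom k" using X(1) Y by (auto simp: Psi_dom_def)
  qed (use X Y in auto)
  have "degree (\<Prod>x\<in>Y. [:-x, 1::real:]) \<le> b"
    using div Y X by (intro U) (auto simp: poly_prod prod_zero_iff)
  then show "card Y \<le> b" using degree_prod_linear[OF Y(2)] by simp
qed

text \<open>Dividing the function of level \<open>k + 1\<close> by \<open>w\<close> yields
  \<open>degree w\<close> further orthogonality relations for level \<open>k\<close> with the weight
  \<open>1/w\<close>, which has constant sign on the interval \<open>D (Suc k)\<close>.\<close>

lemma sign_changes_step:
  assumes adm: "admissible p Q" and k: "k < m"
    and fin: "finite {x \<in> D (Suc k). psi Q k x = 0}"
    and w: "w \<noteq> 0" "\<And>x. x \<in> D (Suc k) \<Longrightarrow> poly w x \<noteq> 0"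
    and div: "real_divides (Psi_dom (Suc k)) w (Psi sig eps Q (Suc k))"
  shows "sign_changes_ge (\<lambda>x. Re (psi Q k x)) (D (Suc k)) (p (Suc k) + degree w)"
proof -
  interpret J: infinite_compact_measure "sig (Suc k)" "D (Suc k)" using measures[of "Suc k"] k by simp
  let ?W = "map_poly complex_of_real w"
  let ?e = "complex_of_real (eps (Suc k))"
  have e: "?e * ?e = 1" using sign[of "Suc k"] k by auto
  have wf: "weight (D (Suc k)) (psi Q k)" using Psi_properties(3)[of k] k by simp
  obtain K where K: "K holomorphic_on Psi_dom (Suc k)"
      "\<And>z. z \<in> Psi_dom (Suc k) \<Longrightarrow> Psi sig eps Q (Suc k) z = poly ?W z * K z"
    using div unfolding real_divides_def by blast
  have mom: "(\<integral>x. psi Q k x / poly ?W (complex_of_real x) * complex_of_real x ^ i \<partial>sig (Suc k)) = 0"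
    if "i < p (Suc k) + degree w" for i
  proof (rule J.moments_quotient[OF wf])
    show "continuous_on (- complex_of_real ` D (Suc k)) (\<lambda>z. ?e * K z)"
      using holomorphic_on_imp_continuous_on[OF K(1)] by (intro continuous_intros) (simp add: Psi_dom_def)
    show "H (Suc k) (psi Q k) z = poly ?W z * (?e * K z)" if "z \<notin> complex_of_real ` D (Suc k)" for z
    proof -
      have "?e * H (Suc k) (psi Q k) z = poly ?W z * K z"
        using K(2)[of z] that unfolding Psi_Suc_eq by (simp add: Psi_dom_def)
      then have "?e * (?e * H (Suc k) (psi Q k) z) = poly ?W z * (?e * K z)" by (simp add: mult_ac)
      then show ?thesis using e by (simp flip: mult.assoc)
    qed
    show "(\<integral>x. psi Q k x * complex_of_real x ^ i \<partial>sig (Suc k)) = 0" if "i < p (Suc k)" for i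
      using adm k that unfolding admissible_def by blast
    show "i < p (Suc k) + degree ?W" using that by (simp add: degree_map_poly_of_real)
  qed (use w in \<open>auto simp: map_poly_of_real_eq_0 poly_of_real_hom\<close>)
  have re: "psi Q k x = complex_of_real (Re (psi Q k x))" for x by (rule psi_real[symmetric])
  show ?thesis
  proof (rule J.orthogonal_sign_changes[where r = "\<lambda>x. 1 / poly w x"])
    have [measurable]: "psi Q k \<in> borel_measurable borel" using psi_measurable k by simp
    show "(\<lambda>x. Re (psi Q k x)) \<in> borel_measurable borel"
      by measurable
    show "continuous_on (D (Suc k)) (\<lambda>x. Re (psi Q k x))"
      by (intro continuous_intros continuous_psi k)
    have "poly w \<in> borel_measurable borel"
      by (intro borel_measurable_continuous_onI continuous_intros)
    then show "(\<lambda>x. 1 / poly w x) \<in> borel_measurable borel" by measurable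
    show "continuous_on (D (Suc k)) (\<lambda>x. 1 / poly w x)"
      using w(2) by (intro continuous_intros) auto
    have "(\<forall>x\<in>D (Suc k). 0 < poly w x) \<or> (\<forall>x\<in>D (Suc k). poly w x < 0)"
      using intervals[of "Suc k"] k w(2) by (intro poly_constant_sign) auto
    then show "(\<forall>x\<in>D (Suc k). 0 < 1 / poly w x) \<or> (\<forall>x\<in>D (Suc k). 1 / poly w x < 0)"
      by (simp add: divide_less_0_iff)
    fix i assume i: "i < p (Suc k) + degree w"
    have "complex_of_real (\<integral>x. Re (psi Q k x) * (1 / poly w x) * x ^ i \<partial>sig (Suc k))
        = (\<integral>x. complex_of_real (Re (psi Q k x) * (1 / poly w x) * x ^ i) \<partial>sig (Suc k))"
      by (rule integral_complex_of_real[symmetric])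
    also have "\<dots> = (\<integral>x. psi Q k x / poly ?W (complex_of_real x) * complex_of_real x ^ i \<partial>sig (Suc k))"
      by (simp add: psi_real poly_of_real_hom)
    finally show "(\<integral>x. Re (psi Q k x) * (1 / poly w x) * x ^ i \<partial>sig (Suc k)) = 0"
      using mom[OF i] by simp
  next
    have "{x \<in> D (Suc k). Re (psi Q k x) = 0} = {x \<in> D (Suc k). psi Q k x = 0}"
      using re by (metis of_real_0 zero_complex.sel(1))
    then show "finite {x \<in> D (Suc k). Re (psi Q k x) = 0}" using fin by simp
  qed
qed

text \<open>The zeros produced lie in \<open>D (Suc k)\<close>, disjoint from the cut of level
  \<open>k\<close>. Hence the divisor has no zero on that cut and can be fed into the step one level
  lower.\<close>

lemma sign_changes_divisor:
  assumes k: "k < m" and sc: "sign_changes_ge (\<lambda>x. Re (psi Q k x)) (D (Suc k)) N"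
  obtains w where "real_divides (Psi_dom k) w (Psi sig eps Q k)" "w \<noteq> 0" "degree w = N"
    "\<And>x. x \<in> cut k \<Longrightarrow> poly w x \<noteq> 0"
proof -
  have cont: "continuous_on (D (Suc k)) (\<lambda>x. Re (psi Q k x))"
    by (intro continuous_intros continuous_psi k)
  have "is_interval (D (Suc k))" using intervals k by simp
  from sign_changes_ge_zeros[OF sc this cont] obtain X where
    X: "X \<subseteq> D (Suc k)" "finite X" "card X = N" "\<forall>x\<in>X. Re (psi Q k x) = 0"
    by metis
  show ?thesis
  proof (rule that)
    show "real_divides (Psi_dom k) (\<Prod>x\<in>X. [:-x, 1:]) (Psi sig eps Q k)"
    proof (rule real_divides_zeros)
      show "Psi sig eps Q k holomorphic_on Psi_dom k" "open (Psi_dom k)"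
        using Psi_properties(2)[of k] open_Psi_dom[of k] k by auto
      show "complex_of_real ` X \<subseteq> Psi_dom k" using D_in_Psi_dom[OF k] X by auto
      show "psi Q k x = 0" if "x \<in> X" for x using X(4) that psi_real[of Q k x] by simp
    qed (rule X)
    show "poly (\<Prod>x\<in>X. [:-x, 1:]) x \<noteq> 0" if "x \<in> cut k" for x
      using cut_disjoint[OF k] that X by (intro poly_prod_linear_nonzero) auto
  qed (use X degree_prod_linear prod_linear_nonzero in auto)
qed

text \<open>A divisor at level \<open>k + 1\<close> gives that many plus \<open>p (Suc k)\<close>
  sign changes at level \<open>k\<close>, hence a divisor of this larger degree there. At level 0 it
  divides the polynomial \<open>Q\<close>.\<close>

lemma divisor_degree_le:
  assumes adm: "admissible p Q" and "k \<le> m"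
    and "real_divides (Psi_dom k) w (Psi sig eps Q k)" "w \<noteq> 0" "\<And>x. x \<in> cut k \<Longrightarrow> poly w x \<noteq> 0"
  shows "degree w + (\<Sum>i=1..k. p i) \<le> degree Q"
  using assms(2-)
proof (induction k arbitrary: w)
  case 0
  obtain K where "K holomorphic_on UNIV"
      "\<And>z. poly (map_poly complex_of_real Q) z = poly (map_poly complex_of_real w) z * K z"
    using 0 unfolding real_divides_def Psi_dom_def cut_def by auto
  then have "degree (map_poly complex_of_real w) \<le> degree (map_poly complex_of_real Q)"
    using adm
    by - (rule degree_le_of_continuous_quotient[where K = K],
        simp_all add: map_poly_of_real_eq_0 admissible_def holomorphic_on_imp_continuous_on)
  then show ?case by (simp add: degree_map_poly_of_real)
next
  case (Suc k)
  have k: "k < m" using Suc.prems by simp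
  \<comment> \<open>The induction hypothesis at level \<open>k\<close> supplies the finiteness of
    zeros that the sign change argument requires.\<close>
  have "degree w \<le> degree Q" if "real_divides (Psi_dom k) w (Psi sig eps Q k)" "w \<noteq> 0"
      "\<And>x. x \<in> cut k \<Longrightarrow> poly w x \<noteq> 0" for w
    using Suc.IH[of w] that k by simp
  then have "finite {x \<in> D (Suc k). psi Q k x = 0}"
    using cut_disjoint[OF k] by (intro finite_zeros[OF k, THEN conjunct1]) auto
  from sign_changes_step[OF adm k this Suc.prems(3) _ Suc.prems(2)] Suc.prems(4)
  have "sign_changes_ge (\<lambda>x. Re (psi Q k x)) (D (Suc k)) (p (Suc k) + degree w)" by simp
  from sign_changes_divisor[OF k this] obtain v where v: "real_divides (Psi_dom k) v (Psi sig eps Q k)"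
    "v \<noteq> 0" "degree v = p (Suc k) + degree w" "\<And>x. x \<in> cut k \<Longrightarrow> poly v x \<noteq> 0"
    by metis
  have "degree v + (\<Sum>i=1..k. p i) \<le> degree Q"
    using Suc.IH[of v] v k by simp
  then show ?case using v(3) by simp
qed

lemma finite_psi_zeros:
  assumes adm: "admissible p Q" and k: "k < m"
  shows "finite {x \<in> D (Suc k). psi Q k x = 0}"
proof -
  have "degree w \<le> degree Q" if "real_divides (Psi_dom k) w (Psi sig eps Q k)" "w \<noteq> 0"
      "\<And>x. x \<in> cut k \<Longrightarrow> poly w x \<noteq> 0" for w
    using divisor_degree_le[OF adm _ that] k by simp
  then show ?thesis
    using cut_disjoint[OF k] by (intro finite_zeros[OF k, THEN conjunct1]) auto
qed

text \<open>Downward induction on the level: the sign changes of level \<open>k + 1\<close> form a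
  divisor, whose degree is added to \<open>p (Suc k)\<close> when passing to level
  \<open>k\<close>.\<close>

lemma sign_changes_lower:
  assumes adm: "admissible p Q" and k: "k < m"
  shows "sign_changes_ge (\<lambda>x. Re (psi Q k x)) (D (Suc k)) (\<Sum>i=Suc k..m. p i)"
proof -
  have "k \<le> m - 1" using k by simp
  then show ?thesis
  proof (induction rule: inc_induct)
    case base
    \<comment> \<open>The induction starts from the trivial divisor 1 at level \<open>m\<close>, so
      level \<open>m - 1\<close> has \<open>p m\<close> sign changes by plain orthogonality.\<close>
    have "real_divides (Psi_dom (Suc (m - 1))) 1 (Psi sig eps Q (Suc (m - 1)))"
      using Psi_properties(2)[of m Q] k unfolding real_divides_def
      by (intro exI[of _ "Psi sig eps Q m"]) simp
    from sign_changes_step[OF adm _ finite_psi_zeros[OF adm] _ _ this] k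
    show ?case by simp
  next
    case (step k)
    then have k: "k < m" "Suc k < m" by auto
    from sign_changes_divisor[OF k(2) step.IH] obtain w where
      w: "real_divides (Psi_dom (Suc k)) w (Psi sig eps Q (Suc k))" "w \<noteq> 0"
        "degree w = (\<Sum>i=Suc (Suc k)..m. p i)" "\<And>x. x \<in> cut (Suc k) \<Longrightarrow> poly w x \<noteq> 0"
      by metis
    from sign_changes_step[OF adm k(1) finite_psi_zeros[OF adm k(1)] w(2) _ w(1)] w(4)
    have "sign_changes_ge (\<lambda>x. Re (psi Q k x)) (D (Suc k)) (p (Suc k) + degree w)" by simp
    moreover have "p (Suc k) + degree w = (\<Sum>i=Suc k..m. p i)"
      using k w(3) by (simp add: sum.atLeast_Suc_atMost[of "Suc k"])
    ultimately show ?case by simp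
  qed
qed

end

section \<open>Simplicity and interlacing of zeros\<close>

lemma simple_zero_factor:
  assumes "F holomorphic_on S" "open S" "a \<in> S" "F a = 0"
  obtains K where "K holomorphic_on S" "\<And>z. z \<in> S \<Longrightarrow> F z = (z - a) * K z" "K a = deriv F a"
proof -
  obtain K where K: "K holomorphic_on S" "\<And>z. z \<in> S \<Longrightarrow> F z = (z - a) * K z"
    using holomorphic_divide_zero[OF assms(1,2,4)] by metis
  have "(K has_field_derivative deriv K a) (at a)"
    using K(1) assms(2,3) holomorphic_derivI by blast
  then have "((\<lambda>z. (z - a) * K z) has_field_derivative K a) (at a)"
    by (auto intro!: derivative_eq_intros)
  then have "(F has_field_derivative K a) (at a)"
    by (rule has_field_derivative_transform_within_open[OF _ assms(2,3)]) (use K(2) in auto)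
  then have "deriv F a = K a" by (rule DERIV_imp_deriv)
  then show ?thesis using that K by metis
qed

lemma zorder_simple_zero:
  assumes "F holomorphic_on S" "open S" "a \<in> S" "F a = 0" "deriv F a \<noteq> 0"
  shows "zorder F a = 1"
proof -
  obtain K where K: "K holomorphic_on S" "\<And>z. z \<in> S \<Longrightarrow> F z = (z - a) * K z" "K a = deriv F a"
    using simple_zero_factor[OF assms(1-4)] by metis
  show ?thesis
    by (rule zorder_eqI[OF assms(2,3) K(1)]) (use K assms(5) in auto)
qed

text \<open>At the endpoints \<open>f = 0\<close>, so the Wronskian condition forbids zeros of
  \<open>g\<close> there. If \<open>g\<close> had none inside either, \<open>f/g\<close> would
  vanish at both ends and have a critical point, where the Wronskian is zero.\<close>

lemma rolle_quotient:
  fixes f g :: "real \<Rightarrow> real"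
  assumes "a < b" "f a = 0" "f b = 0"
    and f: "\<And>x. a \<le> x \<Longrightarrow> x \<le> b \<Longrightarrow> (f has_real_derivative f' x) (at x)"
    and g: "\<And>x. a \<le> x \<Longrightarrow> x \<le> b \<Longrightarrow> (g has_real_derivative g' x) (at x)"
    and W: "\<And>x. a \<le> x \<Longrightarrow> x \<le> b \<Longrightarrow> f x * g' x \<noteq> g x * f' x"
  shows "\<exists>c. a < c \<and> c < b \<and> g c = 0"
proof (rule ccontr)
  assume no: "\<not> ?thesis"
  have nz: "g x \<noteq> 0" if "a \<le> x" "x \<le> b" for x
  proof (cases "x = a \<or> x = b")
    case True
    then show ?thesis using W[OF that] assms(2,3) by auto
  next
    case False
    then show ?thesis using no that by auto
  qed
  have der: "((\<lambda>x. f x / g x) has_real_derivative (f' x * g x - f x * g' x) / (g x * g x)) (at x)"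
    if "a \<le> x" "x \<le> b" for x
    using f[OF that] g[OF that] nz[OF that] by (rule DERIV_divide)
  have "\<exists>z. a < z \<and> z < b \<and> (f' z * g z - f z * g' z) / (g z * g z) = 0"
  proof -
    obtain z where z: "a < z" "z < b"
      "f b / g b - f a / g a = (b - a) * ((f' z * g z - f z * g' z) / (g z * g z))"
      using MVT2[OF assms(1) der] by blast
    then show ?thesis using assms(1-3) by (intro exI[of _ z]) auto
  qed
  then obtain z where z: "a < z" "z < b" "(f' z * g z - f z * g' z) / (g z * g z) = 0" by blast
  then have "f' z * g z = f z * g' z" using nz[of z] by simp
  then show False using W[of z] z by (simp add: mult.commute)
qed

context nikishin
begin

lemma cnj_Psi_dom: "z \<in> Psi_dom k \<Longrightarrow> cnj z \<in> Psi_dom k"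
  unfolding Psi_dom_def by (metis ComplD ComplI complex_cnj_cnj complex_cnj_complex_of_real imageE image_eqI)

text \<open>A real divisor of constant sign on the next interval does not destroy any of the sign
  changes, so its degree adds to their number.\<close>

lemma sign_changes_plus_degree_le:
  assumes adm: "admissible p Q" and k: "k < m"
    and sc: "sign_changes_ge (\<lambda>x. Re (psi Q k x)) (D (Suc k)) N"
    and w: "real_divides (Psi_dom k) w (Psi sig eps Q k)" "w \<noteq> 0" "\<And>x. x \<in> cut k \<Longrightarrow> poly w x \<noteq> 0"
    and sgn: "\<And>x y. x \<in> D (Suc k) \<Longrightarrow> y \<in> D (Suc k) \<Longrightarrow> 0 \<le> poly w x * poly w y"
  shows "N + degree w + (\<Sum>i=1..k. p i) \<le> degree Q"
proof -
  let ?W = "map_poly complex_of_real w"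
  have od: "open (Psi_dom k)" using open_Psi_dom k by simp
  obtain K where K: "K holomorphic_on Psi_dom k" "\<And>z. z \<in> Psi_dom k \<Longrightarrow> Psi sig eps Q k z = poly ?W z * K z"
    using w(1) unfolding real_divides_def by blast
  note Kc = holomorphic_on_imp_continuous_on[OF K(1)]
  \<comment> \<open>The quotient inherits the reflection symmetry off the zeros of \<open>w\<close>,
    and by continuity everywhere. It is therefore real on \<open>D (Suc k)\<close>.\<close>
  have K_cnj: "K z = cnj (K (cnj z))" if "z \<in> Psi_dom k" for z
  proof (rule continuous_on_eq_off_finite[OF od Kc, of _ "{z. poly ?W z = 0}"])
    show "continuous_on (Psi_dom k) (\<lambda>z. cnj (K (cnj z)))"
      by (intro continuous_on_cnj continuous_on_compose2[OF Kc]) (auto intro: cnj_Psi_dom continuous_intros)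
    show "finite {z. poly ?W z = 0}" by (rule poly_roots_finite) (simp add: map_poly_of_real_eq_0 w)
    fix z assume z: "z \<in> Psi_dom k" "z \<notin> {z. poly ?W z = 0}"
    have "poly ?W z * K z = poly ?W z * cnj (K (cnj z))"
      using K(2)[OF z(1)] K(2)[OF cnj_Psi_dom[OF z(1)]] Psi_cnj[of Q k "cnj z"] poly_of_real_cnj[of w "cnj z"]
      by simp
    then show "K z = cnj (K (cnj z))" using z(2) by simp
  qed (rule that)
  have K_real: "Im (K (complex_of_real x)) = 0" if "x \<in> D (Suc k)" for x
    using K_cnj[OF D_in_Psi_dom[OF k that]] by (simp add: complex_eq_iff)
  have psi_K: "Re (psi Q k x) = poly w x * Re (K (complex_of_real x))" if "x \<in> D (Suc k)" for x
    using K(2)[OF D_in_Psi_dom[OF k that]] by (simp add: poly_of_real_hom)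
  have "sign_changes_ge (\<lambda>x. Re (K (complex_of_real x))) (D (Suc k)) N"
  proof -
    obtain xs where xs: "(\<forall>i\<le>N. xs i \<in> D (Suc k)) \<and>
        (\<forall>i<N. xs i < xs (Suc i) \<and> Re (psi Q k (xs i)) * Re (psi Q k (xs (Suc i))) < 0)"
      using sc unfolding sign_changes_ge_def by (elim exE)
    show ?thesis
      unfolding sign_changes_ge_def
    proof (intro exI[of _ xs] conjI allI impI)
      fix i assume i: "i < N"
      show "xs i < xs (Suc i)" using xs i by simp
      have D: "xs i \<in> D (Suc k)" "xs (Suc i) \<in> D (Suc k)" using xs i by simp_all
      have "(poly w (xs i) * poly w (xs (Suc i)))
          * (Re (K (complex_of_real (xs i))) * Re (K (complex_of_real (xs (Suc i))))) < 0"
      proof -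
        have "Re (psi Q k (xs i)) * Re (psi Q k (xs (Suc i))) < 0" using xs i by blast
        then show ?thesis unfolding psi_K[OF D(1)] psi_K[OF D(2)] by (simp only: mult_ac)
      qed
      then show "Re (K (complex_of_real (xs i))) * Re (K (complex_of_real (xs (Suc i)))) < 0"
        using sgn[OF D] by (auto simp: mult_less_0_iff[of "poly w (xs i) * poly w (xs (Suc i))"])
    qed (use xs in simp)
  qed
  moreover have "is_interval (D (Suc k))" using intervals k by simp
  moreover have "continuous_on (D (Suc k)) (\<lambda>x. Re (K (complex_of_real x)))"
    using D_in_Psi_dom[OF k] by (intro continuous_on_Re continuous_on_compose2[OF Kc] continuous_intros) auto
  ultimately obtain X where X: "X \<subseteq> D (Suc k)" "finite X" "card X = N"
      "\<forall>x\<in>X. Re (K (complex_of_real x)) = 0"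
    using sign_changes_ge_zeros by metis
  define v where "v = (\<Prod>x\<in>X. [:-x, 1::real:])"
  have "real_divides (Psi_dom k) v K"
    unfolding v_def
  proof (rule real_divides_zeros[OF K(1) od X(2)])
    show "complex_of_real ` X \<subseteq> Psi_dom k" using D_in_Psi_dom[OF k] X(1) by auto
    show "K (complex_of_real x) = 0" if "x \<in> X" for x
      using X that K_real[of x] by (auto simp: complex_eq_iff)
  qed
  \<comment> \<open>Taking the new zeros from the quotient \<open>K\<close> makes the product a
    divisor even if \<open>w\<close> and \<open>v\<close> share zeros in
    \<open>D (Suc k)\<close>.\<close>
  then have "real_divides (Psi_dom k) (w * v) (Psi sig eps Q k)"
    using K(2) unfolding real_divides_def map_poly_of_real_mult by (auto simp: mult.assoc)
  moreover have "v \<noteq> 0" "degree v = N"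
    unfolding v_def using X degree_prod_linear prod_linear_nonzero by auto
  moreover have "poly v x \<noteq> 0" if "x \<in> cut k" for x
    using cut_disjoint[OF k] that X unfolding v_def by (intro poly_prod_linear_nonzero) auto
  ultimately have "degree (w * v) + (\<Sum>i=1..k. p i) \<le> degree Q"
    using w k by (intro divisor_degree_le[OF adm]) auto
  then show ?thesis using \<open>v \<noteq> 0\<close> \<open>degree v = N\<close> w(2) by (simp add: degree_mult_eq)
qed

lemma sum_split: "k \<le> m \<Longrightarrow> (\<Sum>i=1..k. p i) + (\<Sum>i=Suc k..m. p i) = (\<Sum>i=1..m. p i :: nat)"
  using sum.ub_add_nat[of 1 k p "m - k"] by simp

text \<open>A multiple zero gives the nonnegative divisor \<open>(y - x)^2\<close>. Its degree 2
  adds to the guaranteed sign changes and exceeds the degree bound, which leaves room for only one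
  extra zero.\<close>

lemma psi_zero_simple:
  assumes adm: "admissible p Q" and k: "k < m" and deg: "degree Q \<le> (\<Sum>i=1..m. p i) + 1"
    and x: "complex_of_real x \<in> Psi_dom k" "psi Q k x = 0"
  shows "deriv (Psi sig eps Q k) (complex_of_real x) \<noteq> 0"
proof
  assume d: "deriv (Psi sig eps Q k) (complex_of_real x) = 0"
  have od: "open (Psi_dom k)" and hol: "Psi sig eps Q k holomorphic_on Psi_dom k"
    using open_Psi_dom Psi_properties(2) k by auto
  obtain K where K: "K holomorphic_on Psi_dom k"
      "\<And>z. z \<in> Psi_dom k \<Longrightarrow> Psi sig eps Q k z = (z - complex_of_real x) * K z" "K (complex_of_real x) = 0"
    using simple_zero_factor[OF hol od x] d by metis
  obtain L where L: "L holomorphic_on Psi_dom k" "\<And>z. z \<in> Psi_dom k \<Longrightarrow> K z = (z - complex_of_real x) * L z"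
    using holomorphic_divide_zero[OF K(1) od K(3)] by metis
  define w where "w = [:-x, 1:] * [:-x, 1:]"
  have pw: "poly w y = (y - x) ^ 2" for y unfolding w_def by (simp add: power2_eq_square algebra_simps)
  have "real_divides (Psi_dom k) w (Psi sig eps Q k)"
    unfolding real_divides_def
  proof (intro exI conjI ballI)
    show "L holomorphic_on Psi_dom k" by (rule L)
    fix z assume "z \<in> Psi_dom k"
    then have "Psi sig eps Q k z = (z - complex_of_real x) * (z - complex_of_real x) * L z"
      using K(2) L(2) by (simp add: mult.assoc)
    moreover have "poly (map_poly complex_of_real w) z = (z - complex_of_real x) * (z - complex_of_real x)"
      unfolding w_def map_poly_of_real_mult poly_mult by (simp add: map_poly_pCons)
    ultimately show "Psi sig eps Q k z = poly (map_poly complex_of_real w) z * L z" by simp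
  qed
  moreover have "w \<noteq> 0" "degree w = 2" unfolding w_def by simp_all
  moreover have "poly w y \<noteq> 0" if "y \<in> cut k" for y
    using x(1) that unfolding pw by (auto simp: Psi_dom_def)
  ultimately have "(\<Sum>i=Suc k..m. p i) + degree w + (\<Sum>i=1..k. p i) \<le> degree Q"
    using sign_changes_lower[OF adm k]
    by (intro sign_changes_plus_degree_le[OF adm k]) (auto simp: pw)
  then show False using deg sum_split[of k p] k \<open>degree w = 2\<close> by simp
qed

text \<open>The degree bound leaves no room for any divisor of positive degree without a strict sign
  change on \<open>D (Suc k)\<close>. A nonreal zero with its conjugate gives a positive quadratic,
  a real zero outside the interval a linear factor of constant sign on it.\<close>

lemma Psi_zero_real:
  assumes adm: "admissible p Q" and k: "k < m" and deg: "degree Q \<le> (\<Sum>i=1..m. p i)"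
    and z: "z \<in> Psi_dom k" "Psi sig eps Q k z = 0"
  shows "z \<in> complex_of_real ` D (Suc k)"
proof -
  have od: "open (Psi_dom k)" and hol: "Psi sig eps Q k holomorphic_on Psi_dom k"
    using open_Psi_dom Psi_properties(2) k by auto
  have bound: False if "real_divides (Psi_dom k) w (Psi sig eps Q k)" "degree w > 0"
      "\<And>x. x \<in> cut k \<Longrightarrow> poly w x \<noteq> 0"
      "\<And>x y. x \<in> D (Suc k) \<Longrightarrow> y \<in> D (Suc k) \<Longrightarrow> 0 \<le> poly w x * poly w y" for w
  proof -
    have "w \<noteq> 0" using that(2) by auto
    then have "(\<Sum>i=Suc k..m. p i) + degree w + (\<Sum>i=1..k. p i) \<le> degree Q"
      using that sign_changes_lower[OF adm k] by (intro sign_changes_plus_degree_le[OF adm k]) auto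
    then show False using deg sum_split[of k p] k that(2) by simp
  qed
  have "Im z = 0"
  proof (rule ccontr)
    assume im: "Im z \<noteq> 0"
    define w where "w = [:Re z ^ 2 + Im z ^ 2, - 2 * Re z, 1:]"
    have pw: "poly w x = (x - Re z) ^ 2 + Im z ^ 2" for x
      unfolding w_def by (simp add: power2_eq_square algebra_simps)
    then have pos: "poly w x > 0" for x using im by (simp add: add_nonneg_pos)
    have ne: "z \<noteq> cnj z" using im by (simp add: complex_eq_iff)
    have "\<exists>K. K holomorphic_on Psi_dom k \<and>
        (\<forall>u\<in>Psi_dom k. Psi sig eps Q k u = poly (\<Prod>a\<in>{z, cnj z}. [:-a, 1:]) u * K u)"
      using z cnj_Psi_dom[OF z(1)] Psi_cnj[of Q k z] by (intro holomorphic_divide_zeros hol od) auto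
    moreover have "(\<Prod>a\<in>{z, cnj z}. [:-a, 1:]) = map_poly complex_of_real w"
      using ne unfolding w_def
      by (simp add: map_poly_pCons complex_eq_iff power2_eq_square)
    ultimately have "real_divides (Psi_dom k) w (Psi sig eps Q k)"
      unfolding real_divides_def by simp
    then show False
    proof (rule bound)
      show "degree w > 0" unfolding w_def by simp
      show "poly w x \<noteq> 0" for x using pos[of x] by simp
      show "0 \<le> poly w x * poly w y" for x y using pos[of x] pos[of y] by simp
    qed
  qed
  then have zx: "z = complex_of_real (Re z)" by (simp add: complex_eq_iff)
  have "Re z \<in> D (Suc k)"
  proof (rule ccontr)
    assume out: "Re z \<notin> D (Suc k)"
    have "real_divides (Psi_dom k) (\<Prod>x\<in>{Re z}. [:-x, 1:]) (Psi sig eps Q k)"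
      using z zx by (intro real_divides_zeros hol od) auto
    then have "real_divides (Psi_dom k) [:- Re z, 1:] (Psi sig eps Q k)" by simp
    then show False
    proof (rule bound)
      show "poly [:- Re z, 1:] x \<noteq> 0" if "x \<in> cut k" for x
        using z(1) zx that by (auto simp: Psi_dom_def)
      have int: "is_interval (D (Suc k))" using intervals k by simp
      show "0 \<le> poly [:- Re z, 1:] x * poly [:- Re z, 1:] y" if "x \<in> D (Suc k)" "y \<in> D (Suc k)" for x y
        using mem_is_interval_1_I[OF int that, of "Re z"] mem_is_interval_1_I[OF int that(2,1), of "Re z"] out
        by (cases "x \<le> Re z"; cases "y \<le> Re z") (auto simp: zero_le_mult_iff)
    qed simp
  qed
  then show ?thesis using zx by blast
qed

lemma Psi_zeros_card:
  assumes adm: "admissible p Q" and k: "k < m" and deg: "degree Q \<le> (\<Sum>i=1..m. p i)"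
  shows "finite {z \<in> Psi_dom k. Psi sig eps Q k z = 0} \<and>
    card {z \<in> Psi_dom k. Psi sig eps Q k z = 0} \<le> (\<Sum>i=Suc k..m. p i)"
proof -
  define X where "X = {x \<in> D (Suc k). psi Q k x = 0}"
  have "{z \<in> Psi_dom k. Psi sig eps Q k z = 0} = complex_of_real ` X"
    using Psi_zero_real[OF adm k deg] D_in_Psi_dom[OF k] unfolding X_def by auto
  moreover have "finite X \<and> card X \<le> (\<Sum>i=Suc k..m. p i)"
  proof (rule finite_zeros[OF k])
    show "degree w \<le> (\<Sum>i=Suc k..m. p i)"
      if "real_divides (Psi_dom k) w (Psi sig eps Q k)" "w \<noteq> 0" "\<And>x. x \<in> cut k \<Longrightarrow> poly w x \<noteq> 0" for w
      using divisor_degree_le[OF adm _ that] k deg sum_split[of k p] by simp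
  qed (use cut_disjoint[OF k] in \<open>auto simp: X_def\<close>)
  ultimately show ?thesis by (simp add: card_image inj_on_def)
qed

lemma psi_deriv:
  fixes Q :: "real poly"
  assumes "k \<le> m" "complex_of_real x \<in> Psi_dom k"
  defines "d \<equiv> deriv (Psi sig eps Q k) (complex_of_real x)"
  shows "((\<lambda>x. Re (psi Q k x)) has_real_derivative Re d) (at x)" "complex_of_real (Re d) = d"
proof -
  have "(Psi sig eps Q k has_field_derivative d) (at (complex_of_real x))"
    unfolding d_def using Psi_properties(2)[of k Q] open_Psi_dom[of k] assms(1,2) holomorphic_derivI by blast
  then have v: "((\<lambda>x. psi Q k x) has_vector_derivative d) (at x)"
    by (rule has_vector_derivative_real_field)
  then show "((\<lambda>x. Re (psi Q k x)) has_real_derivative Re d) (at x)"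
    by (rule has_field_derivative_Re)
  have "((\<lambda>x. Im (psi Q k x)) has_real_derivative Im d) (at x)"
    using v by (rule has_field_derivative_Im)
  moreover have "(\<lambda>x. Im (psi Q k x)) = (\<lambda>x. 0)"
    using psi_real[of Q k] by (auto simp: complex_eq_iff)
  ultimately have "Im d = 0" using DERIV_unique[OF _ DERIV_const] by metis
  then show "complex_of_real (Re d) = d" by (simp add: complex_eq_iff)
qed

text \<open>A zero of the Wronskian would give a nontrivial real combination of \<open>P\<close> and
  \<open>Q\<close> whose function has a multiple zero at \<open>x\<close>. The combination is
  admissible for \<open>p\<close> and exceeds the total of \<open>p\<close> in degree by at most
  one, so its zeros are simple.\<close>

lemma wronskian_nonzero:
  assumes P: "admissible p P" and Q: "admissible q Q" and pq: "\<And>j. p j \<le> q j"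
    and deg: "degree P < degree Q" "degree Q \<le> (\<Sum>i=1..m. p i) + 1"
    and k: "k < m" and x: "complex_of_real x \<in> Psi_dom k"
  shows "Re (psi P k x) * Re (deriv (Psi sig eps Q k) (complex_of_real x))
       \<noteq> Re (psi Q k x) * Re (deriv (Psi sig eps P k) (complex_of_real x))"
proof
  define f g f' g' where "f = Re (psi P k x)" and "g = Re (psi Q k x)"
    and "f' = Re (deriv (Psi sig eps P k) (complex_of_real x))"
    and "g' = Re (deriv (Psi sig eps Q k) (complex_of_real x))"
  assume "Re (psi P k x) * Re (deriv (Psi sig eps Q k) (complex_of_real x))
       = Re (psi Q k x) * Re (deriv (Psi sig eps P k) (complex_of_real x))"
  then have W: "f * g' = g * f'" unfolding f_def g_def f'_def g'_def .
  have vals: "psi P k x = complex_of_real f" "psi Q k x = complex_of_real g"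
      "deriv (Psi sig eps P k) (complex_of_real x) = complex_of_real f'"
      "deriv (Psi sig eps Q k) (complex_of_real x) = complex_of_real g'"
    using psi_real psi_deriv(2)[OF _ x] k unfolding f_def g_def f'_def g'_def by auto
  \<comment> \<open>A kernel vector of the singular matrix of values and derivatives:
    \<open>(g, -f)\<close> in general, and \<open>(g', -f')\<close> when both values vanish, where
    \<open>f'\<close> is nonzero by simplicity of the zero for \<open>P\<close>.\<close>
  have "\<exists>a b. (a \<noteq> 0 \<or> b \<noteq> 0) \<and> a * f + b * g = 0 \<and> a * f' + b * g' = 0"
  proof (cases "f = 0 \<and> g = 0")
    case True
    then have "f' \<noteq> 0" using psi_zero_simple[OF P k _ x] deg vals by auto
    then show ?thesis using True by (intro exI[of _ g'] exI[of _ "- f'"]) simp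
  next
    case False
    then show ?thesis using W by (intro exI[of _ g] exI[of _ "- f"]) auto
  qed
  then obtain a b where ab: "a \<noteq> 0 \<or> b \<noteq> 0" "a * f + b * g = 0" "a * f' + b * g' = 0" by blast
  define R where "R = smult a P + smult b Q"
  have "P \<noteq> 0" using P unfolding admissible_def by blast
  \<comment> \<open>The strict inequality of degrees makes \<open>P\<close> and \<open>Q\<close>
    linearly independent.\<close>
  have "R \<noteq> 0"
  proof
    assume "R = 0"
    show False
    proof (cases "b = 0")
      case True
      then show False using \<open>R = 0\<close> ab(1) \<open>P \<noteq> 0\<close> unfolding R_def by simp
    next
      case False
      have "smult b Q = - smult a P" using \<open>R = 0\<close> unfolding R_def by (simp add: add_eq_0_iff)
      then have "degree (smult b Q) = degree (smult a P)" by simp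
      then show False using False deg(1) degree_smult_le[of a P] by simp
    qed
  qed
  then have R: "admissible p R" unfolding R_def by (intro admissible_linear[OF P Q pq])
  have degR: "degree R \<le> (\<Sum>i=1..m. p i) + 1"
    unfolding R_def using deg degree_smult_le[of a P] degree_smult_le[of b Q]
    by (intro degree_add_le) auto
  have od: "open (Psi_dom k)" using open_Psi_dom k by simp
  have der: "(Psi sig eps A k has_field_derivative deriv (Psi sig eps A k) (complex_of_real x))
      (at (complex_of_real x))" for A
    using Psi_properties(2)[of k A] od x k holomorphic_derivI by (metis less_imp_le)
  have lin: "Psi sig eps R k z = complex_of_real a * Psi sig eps P k z + complex_of_real b * Psi sig eps Q k z"
    if "z \<in> Psi_dom k" for z
    unfolding R_def using Psi_linear[OF _ that] k by simp
  have "psi R k x = complex_of_real (a * f + b * g)" unfolding lin[OF x] vals by simp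
  then have "psi R k x = 0" unfolding ab(2) by simp
  have "((\<lambda>z. complex_of_real a * Psi sig eps P k z + complex_of_real b * Psi sig eps Q k z)
      has_field_derivative complex_of_real a * complex_of_real f' + complex_of_real b * complex_of_real g')
      (at (complex_of_real x))"
    using der[of P] der[of Q] unfolding vals by (intro DERIV_add DERIV_cmult)
  then have "(Psi sig eps R k has_field_derivative
      complex_of_real a * complex_of_real f' + complex_of_real b * complex_of_real g') (at (complex_of_real x))"
    by (rule has_field_derivative_transform_within_open[OF _ od x]) (simp add: lin)
  then have "deriv (Psi sig eps R k) (complex_of_real x) = complex_of_real (a * f' + b * g')"
    by (simp add: DERIV_imp_deriv)
  then show False
    using psi_zero_simple[OF R k degR x \<open>psi R k x = 0\<close>] unfolding ab(3) by simp
qed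

text \<open>Zeros of the first function lie in \<open>D (Suc k)\<close>, so the segment between two
  of them stays in that interval and off the cut; the Wronskian is nonzero along it and the quotient
  form of Rolle applies.\<close>

lemma separates_zeros:
  assumes k: "k < m"
    and zP: "{z \<in> Psi_dom k. Psi sig eps P k z = 0} \<subseteq> complex_of_real ` D (Suc k)"
    and W: "\<And>x. complex_of_real x \<in> Psi_dom k \<Longrightarrow>
       Re (psi P k x) * Re (deriv (Psi sig eps Q k) (complex_of_real x))
       \<noteq> Re (psi Q k x) * Re (deriv (Psi sig eps P k) (complex_of_real x))"
  shows "separates {z \<in> Psi_dom k. Psi sig eps P k z = 0} {z \<in> Psi_dom k. Psi sig eps Q k z = 0}"
  unfolding separates_def
proof (intro ballI impI, elim conjE)
  fix u v assume u: "u \<in> {z \<in> Psi_dom k. Psi sig eps P k z = 0}" and v: "v \<in> {z \<in> Psi_dom k. Psi sig eps P k z = 0}"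
    and lt: "Re u < Re v"
  obtain a b where ab: "a \<in> D (Suc k)" "u = complex_of_real a" "b \<in> D (Suc k)" "v = complex_of_real b"
    using zP u v by blast
  have int: "is_interval (D (Suc k))" using intervals k by simp
  have Psi_dom: "complex_of_real x \<in> Psi_dom k" if "a \<le> x" "x \<le> b" for x
    by (rule D_in_Psi_dom[OF k mem_is_interval_1_I[OF int ab(1,3) that]])
  have "\<exists>c. a < c \<and> c < b \<and> Re (psi Q k c) = 0"
  proof (rule rolle_quotient)
    show "a < b" using lt ab by simp
    show "Re (psi P k a) = 0" "Re (psi P k b) = 0" using u v ab by auto
    fix x assume x: "a \<le> x" "x \<le> b"
    show "((\<lambda>x. Re (psi P k x)) has_real_derivative Re (deriv (Psi sig eps P k) (complex_of_real x))) (at x)"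
      "((\<lambda>x. Re (psi Q k x)) has_real_derivative Re (deriv (Psi sig eps Q k) (complex_of_real x))) (at x)"
      using psi_deriv(1)[OF _ Psi_dom[OF x]] k by auto
    show "Re (psi P k x) * Re (deriv (Psi sig eps Q k) (complex_of_real x))
       \<noteq> Re (psi Q k x) * Re (deriv (Psi sig eps P k) (complex_of_real x))"
      by (rule W[OF Psi_dom[OF x]])
  qed
  then obtain c where c: "a < c" "c < b" "Re (psi Q k c) = 0" by blast
  have "psi Q k c = 0" using psi_real[of Q k c] c(3) by simp
  then show "\<exists>c\<in>{z \<in> Psi_dom k. Psi sig eps Q k z = 0}. Re u < Re c \<and> Re c < Re v"
    using c Psi_dom[of c] ab by (intro bexI[of _ "complex_of_real c"]) auto
qed

text \<open>At level 0 the sign changes are zeros of \<open>Q\<close> itself. This forces the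
  polynomial for the raised index to have strictly larger degree than the other.\<close>

lemma admissible_degree_ge:
  assumes "admissible p Q" "0 < m"
  shows "(\<Sum>i=1..m. p i) \<le> degree Q"
proof -
  obtain w where "real_divides (Psi_dom 0) w (Psi sig eps Q 0)" "w \<noteq> 0" "degree w = (\<Sum>i=Suc 0..m. p i)"
      "\<And>x. x \<in> cut 0 \<Longrightarrow> poly w x \<noteq> 0"
    using sign_changes_divisor[OF assms(2) sign_changes_lower[OF assms]] by metis
  then show ?thesis using divisor_degree_le[OF assms(1), of 0 w] by simp
qed

end

section \<open>Zeros and interlacing for neighbouring multi-indices\<close>

theorem theorem4:
  fixes m l :: nat and sig :: "nat \<Rightarrow> real measure" and eps :: "nat \<Rightarrow> real"
    and D :: "nat \<Rightarrow> real set" and n :: "nat \<Rightarrow> nat" and Qn Qnl :: "real poly"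
  assumes intervals: "\<And>j. j \<in> {1..m} \<Longrightarrow> is_interval (D j) \<and> bounded (D j)"
    and disjoint: "\<And>j. 1 \<le> j \<Longrightarrow> j < m \<Longrightarrow> D j \<inter> D (Suc j) = {}"
    and meas: "\<And>j. j \<in> {1..m} \<Longrightarrow> in_class_M (sig j) (D j)"
    and sign: "\<And>j. j \<in> {1..m} \<Longrightarrow> eps j = 1 \<or> eps j = -1"
    and decr: "\<And>i j. 1 \<le> i \<Longrightarrow> i \<le> j \<Longrightarrow> j \<le> m \<Longrightarrow> n j \<le> n i"
    and l: "l \<in> {1..m}"
    and HPn: "typeII_HP sig eps m n Qn"
    and HPnl: "typeII_HP sig eps m (n(l := n l + 1)) Qnl"
  shows "\<forall>k<m.
    (let Dk = (if k = 0 then {} else D k);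
         N = (\<Sum>i=k+1..m. n i);
         f = Psi sig eps Qnl k;
         g = Psi sig eps Qn k;
         Zf = {z. z \<notin> complex_of_real ` Dk \<and> f z = 0};
         Zg = {z. z \<notin> complex_of_real ` Dk \<and> g z = 0}
     in finite Zf \<and> (\<Sum>z\<in>Zf. zorder f z) \<le> int N + 1
        \<and> sign_changes_ge (\<lambda>x. Re (f (complex_of_real x))) (D (Suc k)) N
        \<and> (\<forall>z\<in>Zf. z \<in> \<real> \<and> zorder f z = 1)
        \<and> interlace Zg Zf)"
proof -
  have icm: "infinite_compact_measure (sig j) (D j)" if "j \<in> {1..m}" for j
    by (rule in_class_M_infinite_compact_measure[OF meas[OF that]])
  have "nikishin m sig eps D"
    by (rule nikishin.intro) (fact icm, simp add: intervals, fact disjoint, fact sign)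
  then interpret nikishin m sig eps D .
  define n' where "n' = n(l := n l + 1)"
  have adm: "admissible n Qn"
  proof (rule typeII_HP_admissible[OF HPn])
    fix i j assume "1 \<le> i" "i < j" "j \<le> m"
    then show "n j \<le> n i + 1" using decr[of i j] by simp
  qed
  have adm': "admissible n' Qnl"
  proof (rule typeII_HP_admissible[OF HPnl[folded n'_def]])
    fix i j assume "1 \<le> i" "i < j" "j \<le> m"
    \<comment> \<open>The raised index need not be decreasing: at \<open>j = l\<close> it can exceed
      an earlier entry by one, which is exactly the permitted slack.\<close>
    then show "n' j \<le> n' i + 1" using decr[of i j] by (auto simp: n'_def)
  qed
  have sum': "(\<Sum>i=a..m. n' i) = (\<Sum>i=a..m. n i) + (if l \<in> {a..m} then 1 else 0)" for a
  proof -
    have "(\<Sum>i=a..m. n' i) = (\<Sum>i=a..m. n i + (if i = l then 1 else 0))"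
      by (intro sum.cong) (auto simp: n'_def)
    then show ?thesis by (simp add: sum.distrib)
  qed
  have m0: "0 < m" using l by simp
  have deg: "degree Qn \<le> (\<Sum>i=1..m. n i)" using HPn unfolding typeII_HP_def by blast
  have deg': "degree Qnl \<le> (\<Sum>i=1..m. n' i)" using HPnl unfolding typeII_HP_def n'_def by blast
  have deg'1: "degree Qnl \<le> (\<Sum>i=1..m. n i) + 1" using deg' sum'[of 1] l by simp
  have degs: "degree Qn < degree Qnl"
    using admissible_degree_ge[OF adm' m0] deg sum'[of 1] l by simp
  have le: "n j \<le> n' j" for j by (simp add: n'_def)
  show ?thesis
  proof (intro allI impI)
    fix k assume k: "k < m"
    define N where "N = (\<Sum>i=Suc k..m. n i)"
    define Zf where "Zf = {z \<in> Psi_dom k. Psi sig eps Qnl k z = 0}"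
    define Zg where "Zg = {z \<in> Psi_dom k. Psi sig eps Qn k z = 0}"
    have od: "open (Psi_dom k)" and hol: "Psi sig eps Qnl k holomorphic_on Psi_dom k"
      using open_Psi_dom Psi_properties(2) k by auto
    \<comment> \<open>The relevant sum for \<open>n'\<close> is \<open>N + 1\<close> if
      \<open>l > k\<close> and \<open>N\<close> otherwise.\<close>
    have Zf: "finite Zf" "card Zf \<le> N + 1"
      using Psi_zeros_card[OF adm' k deg'] sum'[of "Suc k"] unfolding Zf_def N_def
      by (auto split: if_splits)
    have Zf_real: "Zf \<subseteq> complex_of_real ` D (Suc k)"
      using Psi_zero_real[OF adm' k deg'] unfolding Zf_def by blast
    have Zg_real: "Zg \<subseteq> complex_of_real ` D (Suc k)"
      using Psi_zero_real[OF adm k deg] unfolding Zg_def by blast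
    have order: "zorder (Psi sig eps Qnl k) z = 1" if z: "z \<in> Zf" for z
    proof -
      obtain x where x: "z = complex_of_real x" using Zf_real z by blast
      have zero: "complex_of_real x \<in> Psi_dom k" "psi Qnl k x = 0" using z unfolding Zf_def x by simp_all
      have "degree Qnl \<le> (\<Sum>i=1..m. n' i) + 1" using deg' by simp
      from psi_zero_simple[OF adm' k this zero] show ?thesis
        unfolding x by (rule zorder_simple_zero[OF hol od zero])
    qed
    have "sign_changes_ge (\<lambda>x. Re (psi Qnl k x)) (D (Suc k)) N"
      using sign_changes_ge_mono[OF sign_changes_lower[OF adm' k], of N] sum'[of "Suc k"]
      unfolding N_def by simp
    moreover have "interlace Zg Zf"
      unfolding interlace_def
    proof (intro conjI)
      show "Zg \<subseteq> \<real>" "Zf \<subseteq> \<real>" using Zf_real Zg_real by auto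
      note W = wronskian_nonzero[OF adm adm' le degs deg'1 k]
      show "Zg \<inter> Zf = {}"
      proof (rule ccontr)
        assume "Zg \<inter> Zf \<noteq> {}"
        then obtain z where z: "z \<in> Zg" "z \<in> Zf" by blast
        then obtain x where "z = complex_of_real x" using Zf_real by blast
        then show False using W[of x] z unfolding Zf_def Zg_def by simp
      qed
      show "separates Zg Zf"
        unfolding Zg_def Zf_def
        by (rule separates_zeros[OF k Zg_real[unfolded Zg_def] W])
      \<comment> \<open>The Wronskian condition is symmetric up to exchanging its two sides, so the
        same lemma applies with the roles of the polynomials reversed.\<close>
      show "separates Zf Zg"
        unfolding Zg_def Zf_def
        by (rule separates_zeros[OF k Zf_real[unfolded Zf_def] not_sym[OF W]])
    qed
    moreover have "(\<Sum>z\<in>Zf. zorder (Psi sig eps Qnl k) z) \<le> int N + 1"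
      using order Zf by simp
    moreover have "\<forall>z\<in>Zf. z \<in> \<real> \<and> zorder (Psi sig eps Qnl k) z = 1"
      using order Zf_real by auto
    moreover have "Zf = {z. z \<notin> complex_of_real ` (if k = 0 then {} else D k) \<and> Psi sig eps Qnl k z = 0}"
      "Zg = {z. z \<notin> complex_of_real ` (if k = 0 then {} else D k) \<and> Psi sig eps Qn k z = 0}"
      unfolding Zf_def Zg_def Psi_dom_def cut_def by auto
    ultimately show "let Dk = (if k = 0 then {} else D k);
         N = (\<Sum>i=k+1..m. n i);
         f = Psi sig eps Qnl k;
         g = Psi sig eps Qn k;
         Zf = {z. z \<notin> complex_of_real ` Dk \<and> f z = 0};
         Zg = {z. z \<notin> complex_of_real ` Dk \<and> g z = 0}
     in finite Zf \<and> (\<Sum>z\<in>Zf. zorder f z) \<le> int N + 1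
        \<and> sign_changes_ge (\<lambda>x. Re (f (complex_of_real x))) (D (Suc k)) N
        \<and> (\<forall>z\<in>Zf. z \<in> \<real> \<and> zorder f z = 1)
        \<and> interlace Zg Zf"
      using Zf(1) unfolding Let_def N_def by simp
  qed
qed

end
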